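(* Let $X$ be a non-empty compact Hausdorff space, $\sigma:X\to X$ a homeomorphism, and $\Sigma=(X,\sigma)$. If $X$ consists of a finite number of points, then the Banach $^*$-algebra $\ell^1(\Sigma)$ is Hermitian.
   Context: Let $\alpha$ be the automorphism of $C(X)$ (continuous complex-valued functions with supremum norm $\|\cdot\|_\infty$) given by $\alpha(f)=f\circ\sigma^{-1}$. The unital Banach $^*$-algebra $\ell^1(\Sigma)$ is the Banach space $\{a:\mathbb Z\to C(X) : \|a\|=\sum_{k\in\mathbb Z}\|a(k)\|_\infty<\infty\}$ with pointwise linear operations, product $(ab)(n)=\sum_{k\in\mathbb Z}a(k)\cdot\alpha^k(b(n-k))$ and involution $a^*(n)=\overline{\alpha^n(a(-n))}$. A unital Banach $^*$-algebra is Hermitian if every self-adjoint element ($a=a^*$) has spectrum contained in $\mathbb R$. *)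

theory Defs
  imports "HOL-Analysis.Analysis" "HOL-Algebra.Module"
begin

text \<open>Complex unital normed \<open>*\<close>-algebras are represented by the record type below, which adds an
  involution and a norm to the HOL-Algebra record of a ring with scalar multiplication.\<close>

record 'b star_algebra = "(complex, 'b) module" +
  star :: "'b \<Rightarrow> 'b"
  nrm :: "'b \<Rightarrow> real"

definition spectrum :: "('b, 'm) star_algebra_scheme \<Rightarrow> 'b \<Rightarrow> complex set" where
  "spectrum A a = {z. z \<odot>\<^bsub>A\<^esub> \<one>\<^bsub>A\<^esub> \<ominus>\<^bsub>A\<^esub> a \<notin> Units A}"

definition hermitian :: "('b, 'm) star_algebra_scheme \<Rightarrow> bool" where
  "hermitian A \<longleftrightarrow> (\<forall>a \<in> carrier A. star A a = a \<longrightarrow> spectrum A a \<subseteq> \<real>)"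

text \<open>The space \<open>X\<close> is the universe of a type. For compact \<open>X\<close> every continuous function is
  bounded, so \<open>C(X)\<close> is the library type of bounded continuous functions, whose norm is the
  supremum norm. The library provides its vector space structure over the reals only.\<close>

type_synonym 'x cfun = "'x \<Rightarrow>\<^sub>C complex"

text \<open>\<open>Bcontfun\<close> is only meaningful on bounded continuous functions; the lemmas below confirm
  that the operations are the pointwise ones (for \<open>cfun_auto\<close>: when \<open>\<sigma>\<close> is a homeomorphism).\<close>

definition cfun_mult :: "'x::topological_space cfun \<Rightarrow> 'x cfun \<Rightarrow> 'x cfun" where
  "cfun_mult f g = Bcontfun (\<lambda>x. apply_bcontfun f x * apply_bcontfun g x)"

definition cfun_scale :: "complex \<Rightarrow> 'x::topological_space cfun \<Rightarrow> 'x cfun" where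
  "cfun_scale c f = Bcontfun (\<lambda>x. c * apply_bcontfun f x)"

definition cfun_cnj :: "'x::topological_space cfun \<Rightarrow> 'x cfun" where
  "cfun_cnj f = Bcontfun (\<lambda>x. cnj (apply_bcontfun f x))"

definition cfun_auto :: "('x::topological_space \<Rightarrow> 'x) \<Rightarrow> 'x cfun \<Rightarrow> 'x cfun" where
  "cfun_auto \<sigma> f = Bcontfun (apply_bcontfun f \<circ> inv_into UNIV \<sigma>)"

lemma apply_cfun_mult: "apply_bcontfun (cfun_mult f g) x = apply_bcontfun f x * apply_bcontfun g x"
proof -
  have "norm (apply_bcontfun f x * apply_bcontfun g x) \<le> norm f * norm g" for x
    unfolding norm_mult by (intro mult_mono norm_bounded norm_ge_zero)
  moreover have "continuous_on UNIV (\<lambda>x. apply_bcontfun f x * apply_bcontfun g x)"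
    by (intro continuous_intros continuous_on_apply_bcontfun)
  ultimately show ?thesis
    unfolding cfun_mult_def by (subst Bcontfun_inverse) (rule bcontfun_normI, assumption+, simp)
qed

lemma apply_cfun_scale: "apply_bcontfun (cfun_scale c f) x = c * apply_bcontfun f x"
proof -
  have "cfun_scale c f = cfun_mult (const_bcontfun c) f"
    by (simp add: cfun_scale_def cfun_mult_def const_bcontfun.rep_eq)
  then show ?thesis
    by (simp add: apply_cfun_mult const_bcontfun.rep_eq)
qed

lemma apply_cfun_cnj: "apply_bcontfun (cfun_cnj f) x = cnj (apply_bcontfun f x)"
proof -
  have "continuous_on UNIV (\<lambda>x. cnj (apply_bcontfun f x))"
    by (intro continuous_intros continuous_on_apply_bcontfun)
  moreover have "norm (cnj (apply_bcontfun f x)) \<le> norm f" for x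
    by (simp add: norm_bounded)
  ultimately show ?thesis
    unfolding cfun_cnj_def by (subst Bcontfun_inverse) (rule bcontfun_normI, assumption+, simp)
qed

lemma apply_cfun_auto:
  assumes "homeomorphism UNIV UNIV \<sigma> \<tau>"
  shows "apply_bcontfun (cfun_auto \<sigma> f) x = apply_bcontfun f (inv_into UNIV \<sigma> x)"
proof -
  have "inv_into UNIV \<sigma> = \<tau>"
    using assms by (intro inv_equality) (auto simp: homeomorphism_def)
  then have "continuous_on UNIV (apply_bcontfun f \<circ> inv_into UNIV \<sigma>)"
    using assms by (intro continuous_on_compose continuous_on_apply_bcontfun)
      (simp add: homeomorphism_def)
  moreover have "norm ((apply_bcontfun f \<circ> inv_into UNIV \<sigma>) x) \<le> norm f" for x
    by (simp add: norm_bounded)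
  ultimately show ?thesis
    unfolding cfun_auto_def by (subst Bcontfun_inverse) (rule bcontfun_normI, assumption+, simp)
qed

text \<open>Integer iterates of a bijection.\<close>

definition iterate :: "('c \<Rightarrow> 'c) \<Rightarrow> int \<Rightarrow> 'c \<Rightarrow> 'c" where
  "iterate f k = (if k \<ge> 0 then f ^^ nat k else inv_into UNIV f ^^ nat (- k))"

text \<open>In the product, the infinite sum is taken in the Banach space \<open>C(X)\<close>, i.e. it converges
  unconditionally in the supremum norm.\<close>

definition ell1 :: "('x::topological_space \<Rightarrow> 'x) \<Rightarrow> (int \<Rightarrow> 'x cfun) star_algebra" where
  "ell1 \<sigma> =
    \<lparr> carrier = {a. (\<lambda>k. norm (a k)) summable_on UNIV},
      monoid.mult = (\<lambda>a b n. \<Sum>\<^sub>\<infinity>k. cfun_mult (a k) (iterate (cfun_auto \<sigma>) k (b (n - k)))),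
      one = (\<lambda>n. if n = 0 then const_bcontfun 1 else 0),
      zero = (\<lambda>n. 0),
      add = (\<lambda>a b n. a n + b n),
      smult = (\<lambda>c a n. cfun_scale c (a n)),
      star = (\<lambda>a n. cfun_cnj (iterate (cfun_auto \<sigma>) n (a (- n)))),
      nrm = (\<lambda>a. \<Sum>\<^sub>\<infinity>k. norm (a k)) \<rparr>"

end

theory Submission
  imports Defs
begin

text \<open>
  Let \<open>a\<close> be self-adjoint and \<open>z\<close> non-real. A function on the points of \<open>X\<close> with values in the
  absolutely convergent Laurent series on the unit circle is the same thing as an element \<open>u\<close> of
  \<open>\<ell>\<^sup>1(\<Sigma>)\<close>: send \<open>u\<close> to the functions \<open>\<Sum>n. u n x * t^n\<close>. Under this identification left
  multiplication by an element \<open>b\<close> becomes, for every \<open>t\<close> on the circle, multiplication by a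
  finite matrix, whose entry at \<open>(x, y)\<close> is \<open>\<Sum>k. b k x * t^k\<close> over those \<open>k\<close> for which the
  \<open>k\<close>-th iterate of \<open>\<sigma>\<close> takes \<open>y\<close> to \<open>x\<close>. The matrix of a self-adjoint element is Hermitian, so the
  matrix of \<open>b = z - a\<close> has the form \<open>z - H\<close> with \<open>H\<close> Hermitian and satisfies
  \<open>\<langle>\<xi>, (z - H) \<xi>\<rangle> \<noteq> 0\<close> whenever \<open>\<xi> \<noteq> 0\<close> (\<open>sesq_resolvent_nondegenerate\<close>).

  Finding a right inverse of \<open>b\<close> therefore amounts to solving a finite linear system whose
  coefficients are absolutely convergent Laurent series and whose solution has to be of that kind,
  too. Gaussian elimination does this (\<open>wiener_solve\<close>): the nondegeneracy of the form makes the
  diagonal entries vanish nowhere on the circle and is inherited by Schur complements, and one can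
  divide by a nowhere vanishing absolutely convergent series by Wiener's lemma
  (\<open>wiener_inverse\<close>). If \<open>b u = 1\<close>, then \<open>b (u b) = b\<close>, and the injectivity of the matrices of
  \<open>b\<close> gives \<open>u b = 1\<close>, so \<open>z - a\<close> is invertible.

  Wiener's lemma is proved by a Neumann series. After passing to \<open>1 - |f|\<^sup>2 / M\<^sup>2\<close> one has to invert
  \<open>1 - h\<close> where \<open>|h| \<le> r < 1\<close> on the circle, which needs \<open>\<Sum>n. \<parallel>h^n\<parallel> < \<infinity>\<close> in the norm
  given by the sum of the moduli of the coefficients. For a Laurent polynomial \<open>p\<close> of degree \<open>d\<close>
  each coefficient of \<open>p^j\<close> has modulus at most \<open>(sup |p|)^j\<close>, and there are only \<open>2 j d + 1\<close> of them; writing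
  \<open>h = p + e\<close> with \<open>e\<close> small in norm and expanding \<open>(p + e)^n\<close> gives
  \<open>\<parallel>h^n\<parallel> \<le> (2 n d + 1) (sup |p| + \<parallel>e\<parallel>)^n\<close>, which is summable.
\<close>

section \<open>Absolutely convergent Laurent series on the unit circle\<close>

text \<open>
  \<open>M\<close> is only an upper bound for the norm of \<open>f\<close> in the Wiener algebra, so that sums, products and
  limits can be estimated without reference to the uniqueness of the coefficients.
\<close>

definition wiener_le :: "(complex \<Rightarrow> complex) \<Rightarrow> real \<Rightarrow> bool" where
  "wiener_le f M \<longleftrightarrow> (\<exists>c::int \<Rightarrow> complex. (\<lambda>k. norm (c k)) summable_on UNIV \<and> (\<Sum>\<^sub>\<infinity>k. norm (c k)) \<le> M \<and>
     (\<forall>t. norm t = 1 \<longrightarrow> ((\<lambda>k. c k * t powi k) has_sum f t) UNIV))"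

lemma norm_circle_powi: "norm t = 1 \<Longrightarrow> norm (t powi k) = 1" for t :: complex
  by (simp add: norm_power_int)

lemma circle_nonzero: "norm t = 1 \<Longrightarrow> t \<noteq> 0" for t :: complex
  by auto

lemma circle_series_summable:
  fixes c :: "int \<Rightarrow> complex"
  assumes "(\<lambda>k. norm (c k)) summable_on UNIV" and "norm t = 1"
  shows "(\<lambda>k. c k * t powi k) summable_on UNIV"
  by (rule abs_summable_summable) (use assms in \<open>simp add: norm_mult norm_circle_powi\<close>)

lemma wiener_leI:
  fixes c :: "int \<Rightarrow> complex"
  assumes "(\<lambda>k. norm (c k)) summable_on UNIV" and "(\<Sum>\<^sub>\<infinity>k. norm (c k)) \<le> M"
    and "\<And>t. norm t = 1 \<Longrightarrow> (\<Sum>\<^sub>\<infinity>k. c k * t powi k) = f t"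
  shows "wiener_le f M"
proof -
  have "((\<lambda>k. c k * t powi k) has_sum f t) UNIV" if "norm t = 1" for t
    using has_sum_infsum[OF circle_series_summable[OF assms(1) that]] assms(3)[OF that] by simp
  with assms(1,2) show ?thesis unfolding wiener_le_def by blast
qed

lemma wiener_le_cong:
  assumes "wiener_le f M" and "\<And>t. norm t = 1 \<Longrightarrow> f t = g t"
  shows "wiener_le g M"
  using assms unfolding wiener_le_def by metis

lemma wiener_le_mono: "wiener_le f M \<Longrightarrow> M \<le> N \<Longrightarrow> wiener_le f N"
  unfolding wiener_le_def using order_trans by blast

lemma wiener_le_norm:
  assumes "wiener_le f M" and "norm t = 1"
  shows "norm (f t) \<le> M"
proof -
  obtain c :: "int \<Rightarrow> complex" where c: "(\<lambda>k. norm (c k)) summable_on UNIV" "(\<Sum>\<^sub>\<infinity>k. norm (c k)) \<le> M"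
    "((\<lambda>k. c k * t powi k) has_sum f t) UNIV"
    using assms unfolding wiener_le_def by blast
  have "norm (f t) \<le> (\<Sum>\<^sub>\<infinity>k. norm (c k))"
    by (rule norm_infsum_le[OF c(3) has_sum_infsum[OF c(1)]])
      (simp add: norm_mult norm_circle_powi assms(2))
  with c(2) show ?thesis by simp
qed

lemma wiener_le_nonneg: "wiener_le f M \<Longrightarrow> 0 \<le> M"
  using wiener_le_norm[of f M 1] norm_ge_zero[of "f 1"] by (meson norm_one order_trans)

text \<open>
  This is the completeness of the Wiener algebra in the form used throughout: the coefficients of
  the sum are the sums of the coefficients, by Fubini's theorem for the double family. Finite sums,
  products and the Neumann series are all instances.
\<close>

lemma wiener_le_has_sum:
  assumes f: "\<And>i. i \<in> A \<Longrightarrow> wiener_le (f i) (M i)"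
    and M: "M summable_on A"
    and g: "\<And>t. norm t = 1 \<Longrightarrow> ((\<lambda>i. f i t) has_sum g t) A"
  shows "wiener_le g (infsum M A)"
proof -
  have "\<forall>i\<in>A. \<exists>c::int \<Rightarrow> complex. (\<lambda>k. norm (c k)) summable_on UNIV \<and> (\<Sum>\<^sub>\<infinity>k. norm (c k)) \<le> M i \<and>
     (\<forall>t. norm t = 1 \<longrightarrow> ((\<lambda>k. c k * t powi k) has_sum f i t) UNIV)"
    using f unfolding wiener_le_def by blast
  then obtain c :: "'a \<Rightarrow> int \<Rightarrow> complex" where c:
    "\<And>i. i \<in> A \<Longrightarrow> (\<lambda>k. norm (c i k)) summable_on UNIV"
    "\<And>i. i \<in> A \<Longrightarrow> (\<Sum>\<^sub>\<infinity>k. norm (c i k)) \<le> M i"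
    "\<And>i t. i \<in> A \<Longrightarrow> norm t = 1 \<Longrightarrow> ((\<lambda>k. c i k * t powi k) has_sum f i t) UNIV"
    by metis
  have sumA: "(\<lambda>i. \<Sum>\<^sub>\<infinity>k. norm (c i k)) summable_on A"
    by (rule summable_on_comparison_test[OF M]) (auto simp: c(2) infsum_nonneg)
  then have "(\<lambda>i. norm (\<Sum>\<^sub>\<infinity>k. norm (c i k))) summable_on A"
    by (simp add: infsum_nonneg)
  then have absA: "(\<lambda>x. norm ((\<lambda>(i,k). c i k) x)) summable_on A \<times> UNIV"
    by (subst Infinite_Sum.abs_summable_on_Sigma_iff) (auto simp: c(1))
  then have abs': "(\<lambda>(i,k). norm (c i k)) summable_on A \<times> UNIV"
    by (simp add: case_prod_unfold)
  then have abs'': "(\<lambda>(k,i). norm (c i k)) summable_on UNIV \<times> A"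
    by (subst (asm) summable_on_swap) (simp add: case_prod_unfold)
  have colabs: "(\<lambda>i. norm (c i k)) summable_on A" for k
    using summable_on_SigmaD1[OF abs''] by simp
  define s where "s k = infsum (\<lambda>i. c i k) A" for k
  have s_le: "norm (s k) \<le> infsum (\<lambda>i. norm (c i k)) A" for k
    unfolding s_def by (rule norm_infsum_bound) (rule colabs)
  have colsum: "(\<lambda>k. infsum (\<lambda>i. norm (c i k)) A) summable_on UNIV"
    by (rule summable_on_Sigma_banach[OF abs''])
  have s_abs: "(\<lambda>k. norm (s k)) summable_on UNIV"
    by (rule Infinite_Sum.abs_summable_on_comparison_test'[OF colsum s_le])
  show ?thesis
  proof (rule wiener_leI[of s])
    show "(\<lambda>k. norm (s k)) summable_on UNIV" by (fact s_abs)
    have "(\<Sum>\<^sub>\<infinity>k. norm (s k)) \<le> (\<Sum>\<^sub>\<infinity>k. infsum (\<lambda>i. norm (c i k)) A)"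
      by (rule infsum_mono[OF s_abs colsum s_le])
    also have "\<dots> = infsum (\<lambda>i. \<Sum>\<^sub>\<infinity>k. norm (c i k)) A"
      by (rule infsum_swap_banach[OF abs''])
    also have "\<dots> \<le> infsum M A"
      by (rule infsum_mono[OF sumA M c(2)])
    finally show "(\<Sum>\<^sub>\<infinity>k. norm (s k)) \<le> infsum M A" .
  next
    fix t :: complex assume t: "norm t = 1"
    have "(\<lambda>x. norm ((\<lambda>(i,k). c i k * t powi k) x)) summable_on A \<times> UNIV"
      using abs' by (simp add: case_prod_unfold norm_mult norm_circle_powi[OF t])
    then have "(\<lambda>(i,k). c i k * t powi k) summable_on A \<times> UNIV"
      by (rule abs_summable_summable)
    from infsum_swap_banach[OF this]
    have "(\<Sum>\<^sub>\<infinity>k. infsum (\<lambda>i. c i k * t powi k) A) = infsum (\<lambda>i. \<Sum>\<^sub>\<infinity>k. c i k * t powi k) A"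
      by simp
    also have "\<dots> = infsum (\<lambda>i. f i t) A"
      by (rule infsum_cong) (simp add: infsumI[OF c(3)[OF _ t]])
    also have "\<dots> = g t" by (rule infsumI[OF g[OF t]])
    finally show "(\<Sum>\<^sub>\<infinity>k. s k * t powi k) = g t"
      by (simp add: s_def infsum_cmult_left')
  qed
qed

lemma wiener_le_monom: "wiener_le (\<lambda>t. a * t powi k) (norm a)"
proof -
  have 1: "((\<lambda>j. norm (if j = k then a else 0)) has_sum norm a) UNIV"
    by (rule has_sum_finite_neutralI[of "{k}"]) auto
  have 2: "((\<lambda>j. (if j = k then a else 0) * t powi j) has_sum a * t powi k) UNIV" for t
    by (rule has_sum_finite_neutralI[of "{k}"]) auto
  show ?thesis
    unfolding wiener_le_def
    using 1 2 infsumI[OF 1] has_sum_imp_summable[OF 1] by (intro exI[of _ "\<lambda>j. if j = k then a else 0"]) auto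
qed

lemma wiener_le_const: "wiener_le (\<lambda>t. a) (norm a)"
  using wiener_le_monom[of a 0] by simp

lemma wiener_le_sum:
  assumes "finite S" and "\<And>i. i \<in> S \<Longrightarrow> wiener_le (f i) (M i)"
  shows "wiener_le (\<lambda>t. \<Sum>i\<in>S. f i t) (\<Sum>i\<in>S. M i)"
  using wiener_le_has_sum[of S f M "\<lambda>t. \<Sum>i\<in>S. f i t"] assms by simp

lemma wiener_le_add:
  assumes "wiener_le f M" and "wiener_le g N"
  shows "wiener_le (\<lambda>t. f t + g t) (M + N)"
  using wiener_le_sum[of "UNIV :: bool set" "\<lambda>b. if b then f else g" "\<lambda>b. if b then M else N"] assms
  by (simp add: UNIV_bool add.commute)

lemma wiener_le_monom_mult:
  assumes "wiener_le f M"
  shows "wiener_le (\<lambda>t. a * t powi k * f t) (norm a * M)"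
proof -
  obtain c :: "int \<Rightarrow> complex" where c: "(\<lambda>k. norm (c k)) summable_on UNIV" "(\<Sum>\<^sub>\<infinity>k. norm (c k)) \<le> M"
    "\<And>t. norm t = 1 \<Longrightarrow> ((\<lambda>k. c k * t powi k) has_sum f t) UNIV"
    using assms unfolding wiener_le_def by blast
  have bij: "bij_betw (\<lambda>j. j - k) UNIV UNIV" 
    by (rule bij_betwI[of _ _ _ "\<lambda>j. j + k"]) auto
  have abs: "(\<lambda>j. norm (c (j - k))) summable_on UNIV"
    using summable_on_reindex_bij_betw[OF bij, of "\<lambda>j. norm (c j)"] c(1) by simp
  show ?thesis
  proof (rule wiener_leI[of "\<lambda>j. a * c (j - k)"])
    show "(\<lambda>j. norm (a * c (j - k))) summable_on UNIV"
      by (simp add: norm_mult summable_on_cmult_right abs)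
    have "(\<Sum>\<^sub>\<infinity>j. norm (a * c (j - k))) = norm a * (\<Sum>\<^sub>\<infinity>j. norm (c (j - k)))"
      by (simp add: norm_mult infsum_cmult_right')
    also have "(\<Sum>\<^sub>\<infinity>j. norm (c (j - k))) = (\<Sum>\<^sub>\<infinity>j. norm (c j))"
      by (rule infsum_reindex_bij_betw[OF bij])
    finally show "(\<Sum>\<^sub>\<infinity>j. norm (a * c (j - k))) \<le> norm a * M"
      using c(2) by (simp add: mult_left_mono)
  next
    fix t :: complex assume t: "norm t = 1"
    have shift: "t powi k * t powi (j - k) = t powi j" for j
      using circle_nonzero[OF t] power_int_add[of t k "j - k"] by simp
    have "(\<Sum>\<^sub>\<infinity>j. a * c (j - k) * t powi j) = (\<Sum>\<^sub>\<infinity>j. a * t powi k * (c (j - k) * t powi (j - k)))"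
      by (rule infsum_cong, subst shift[symmetric]) (simp only: mult_ac)
    also have "\<dots> = a * t powi k * (\<Sum>\<^sub>\<infinity>j. c (j - k) * t powi (j - k))"
      by (rule infsum_cmult_right')
    also have "(\<Sum>\<^sub>\<infinity>j. c (j - k) * t powi (j - k)) = (\<Sum>\<^sub>\<infinity>j. c j * t powi j)"
      by (rule infsum_reindex_bij_betw[OF bij])
    also have "\<dots> = f t" by (rule infsumI[OF c(3)[OF t]])
    finally show "(\<Sum>\<^sub>\<infinity>j. a * c (j - k) * t powi j) = a * t powi k * f t" .
  qed
qed

text \<open>
  The product is the sum of the functions \<open>c k * t^k * g t\<close>, each of which has the coefficients of
  \<open>g\<close>, shifted and scaled; convolutions need not be written out.
\<close>

lemma wiener_le_mult:
  assumes f: "wiener_le f M" and g: "wiener_le g N"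
  shows "wiener_le (\<lambda>t. f t * g t) (M * N)"
proof -
  obtain c :: "int \<Rightarrow> complex" where c: "(\<lambda>k. norm (c k)) summable_on UNIV" "(\<Sum>\<^sub>\<infinity>k. norm (c k)) \<le> M"
    "\<And>t. norm t = 1 \<Longrightarrow> ((\<lambda>k. c k * t powi k) has_sum f t) UNIV"
    using f unfolding wiener_le_def by blast
  have "wiener_le (\<lambda>t. f t * g t) (\<Sum>\<^sub>\<infinity>k. norm (c k) * N)"
  proof (rule wiener_le_has_sum)
    show "wiener_le (\<lambda>t. c k * t powi k * g t) (norm (c k) * N)" for k
      by (rule wiener_le_monom_mult[OF g])
    show "(\<lambda>k. norm (c k) * N) summable_on UNIV"
      using c(1) by (rule summable_on_cmult_left)
    show "((\<lambda>k. c k * t powi k * g t) has_sum f t * g t) UNIV" if "norm t = 1" for t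
      by (rule has_sum_cmult_left[OF c(3)[OF that]])
  qed
  moreover have "(\<Sum>\<^sub>\<infinity>k. norm (c k) * N) \<le> M * N"
    using c(2) wiener_le_nonneg[OF g] by (simp add: infsum_cmult_left' mult_right_mono)
  ultimately show ?thesis by (rule wiener_le_mono)
qed

lemma wiener_le_power: "wiener_le f M \<Longrightarrow> wiener_le (\<lambda>t. f t ^ n) (M ^ n)"
proof (induction n)
  case 0
  then show ?case using wiener_le_const[of 1] by simp
next
  case (Suc n)
  then show ?case using wiener_le_mult[of f M "\<lambda>t. f t ^ n" "M ^ n"] by simp
qed

lemma wiener_le_cnj:
  assumes "wiener_le f M"
  shows "wiener_le (\<lambda>t. cnj (f t)) M"
proof -
  obtain c :: "int \<Rightarrow> complex" where c: "(\<lambda>k. norm (c k)) summable_on UNIV" "(\<Sum>\<^sub>\<infinity>k. norm (c k)) \<le> M"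
    "\<And>t. norm t = 1 \<Longrightarrow> ((\<lambda>k. c k * t powi k) has_sum f t) UNIV"
    using assms unfolding wiener_le_def by blast
  have "wiener_le (\<lambda>t. cnj (f t)) (\<Sum>\<^sub>\<infinity>k. norm (cnj (c k)))"
  proof (rule wiener_le_has_sum)
    show "wiener_le (\<lambda>t. cnj (c k) * t powi (-k)) (norm (cnj (c k)))" for k
      by (rule wiener_le_monom)
    show "(\<lambda>k. norm (cnj (c k))) summable_on UNIV" using c(1) by simp
    show "((\<lambda>k. cnj (c k) * t powi (-k)) has_sum cnj (f t)) UNIV" if t: "norm t = 1" for t
    proof -
      have "cnj t = inverse t"
        using divide_conv_cnj[OF t, of 1] by (simp add: inverse_eq_divide)
      then have "cnj (c k * t powi k) = cnj (c k) * t powi (-k)" for k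
        by (simp add: power_int_def power_inverse)
      then show ?thesis using c(3)[OF t] has_sum_cnj_iff[of "\<lambda>k. c k * t powi k" UNIV "f t"] by (simp only:)
    qed
  qed
  then show ?thesis using c(2) wiener_le_mono by auto
qed

section \<open>Laurent polynomials and their coefficients\<close>

definition laurent_poly :: "nat \<Rightarrow> (complex \<Rightarrow> complex) \<Rightarrow> bool" where
  "laurent_poly d p \<longleftrightarrow>
     (\<exists>c. \<forall>t. norm t = 1 \<longrightarrow> p t = (\<Sum>k\<in>{-int d..int d}. c k * t powi k))"

text \<open>
  The degree grows only linearly in the exponent. This makes the number of coefficients
  harmless against the exponential decay in the Neumann series.
\<close>

lemma laurent_poly_power:
  assumes "laurent_poly d p"
  shows "laurent_poly (j * d) (\<lambda>t. p t ^ j)"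
proof (induction j)
  case 0
  then show ?case by (auto simp: laurent_poly_def intro!: exI[of _ "\<lambda>_. 1"])
next
  case (Suc j)
  obtain a where a: "\<And>t. norm t = 1 \<Longrightarrow> p t = (\<Sum>k\<in>{-int d..int d}. a k * t powi k)"
    using assms unfolding laurent_poly_def by blast
  define J where "J = {-int (j * d)..int (j * d)}"
  define S where "S = {-int (Suc j * d)..int (Suc j * d)}"
  obtain b where b: "\<And>t. norm t = 1 \<Longrightarrow> p t ^ j = (\<Sum>m\<in>J. b m * t powi m)"
    using Suc unfolding laurent_poly_def J_def by blast
  define D where "D = {-int d..int d} \<times> J"
  have D: "(\<lambda>(k,m). k + m) ` D \<subseteq> S"
    by (auto simp: D_def J_def S_def algebra_simps)
  define c where "c n = (\<Sum>(k,m)\<in>{x\<in>D. (\<lambda>(k,m). k + m) x = n}. a k * b m)" for n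
  have "p t ^ Suc j = (\<Sum>n\<in>S. c n * t powi n)" if t: "norm t = 1" for t
  proof -
    have "p t ^ Suc j = (\<Sum>(k,m)\<in>D. (a k * t powi k) * (b m * t powi m))"
      by (subst power_Suc, subst b[OF t], subst a[OF t])
        (simp add: sum_product sum.cartesian_product D_def)
    also have "\<dots> = (\<Sum>(k,m)\<in>D. a k * b m * t powi (k + m))"
      using circle_nonzero[OF t] by (intro sum.cong) (auto simp: power_int_add)
    also have "\<dots> = (\<Sum>n\<in>S. \<Sum>(k,m)\<in>{x\<in>D. (\<lambda>(k,m). k + m) x = n}. a k * b m * t powi (k + m))"
      by (rule sum.group[symmetric, OF _ _ D]) (auto simp: D_def J_def S_def)
    also have "\<dots> = (\<Sum>n\<in>S. c n * t powi n)"
      unfolding c_def sum_distrib_right by (intro sum.cong) auto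
    finally show ?thesis .
  qed
  then show ?case unfolding laurent_poly_def S_def by blast
qed

lemma sum_roots_of_unity:
  fixes n :: int
  assumes "n \<noteq> 0" and "\<bar>n\<bar> < int N"
  shows "(\<Sum>j<N. cis (2 * pi * real_of_int n * real j / real N)) = 0"
proof -
  define z where "z = cis (2 * pi * real_of_int n / real N)"
  have N: "N > 0" using assms by auto
  have zj: "z ^ j = cis (2 * pi * real_of_int n * real j / real N)" for j
    unfolding z_def Complex.DeMoivre by (rule arg_cong[where f = cis]) simp
  have "z ^ N = cis (2 * pi * real_of_int n)"
    using N by (simp add: zj)
  then have "z ^ N = 1" by (simp add: cis_multiple_2pi)
  moreover have "z \<noteq> 1"
  proof
    assume "z = 1"
    then have "cos (2 * pi * real_of_int n / real N) = 1"
      by (metis z_def cis.sel(1) one_complex.sel(1))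
    then obtain m :: int where "2 * pi * real_of_int n / real N = real_of_int m * 2 * pi"
      by (auto simp: cos_one_2pi_int)
    then have "real_of_int n = real_of_int m * real N" using N by (simp add: field_simps)
    then have "n = m * int N" by (metis of_int_eq_iff of_int_mult of_int_of_nat_eq)
    then show False using assms by (auto simp: abs_mult)
  qed
  ultimately have "(\<Sum>j<N. z ^ j) = 0" by (simp add: geometric_sum)
  then show ?thesis by (simp add: zj)
qed

text \<open>
  A coefficient is the mean of \<open>p t * t^(-k)\<close> over the \<open>N\<close>-th roots of unity as soon as \<open>N\<close>
  exceeds all differences of exponents, and a mean is bounded by the supremum.
\<close>

lemma laurent_coeff_bound:
  fixes c :: "int \<Rightarrow> complex"
  assumes p: "\<And>t. norm t = 1 \<Longrightarrow> p t = (\<Sum>k\<in>S. c k * t powi k)"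
    and B: "\<And>t. norm t = 1 \<Longrightarrow> norm (p t) \<le> B"
    and S: "finite S" "k \<in> S"
  shows "norm (c k) \<le> B"
proof -
  define N where "N = Suc (\<Sum>m\<in>S. nat \<bar>m - k\<bar>)"
  have N: "\<bar>m - k\<bar> < int N" if "m \<in> S" for m
  proof -
    have "nat \<bar>m - k\<bar> \<le> (\<Sum>m\<in>S. nat \<bar>m - k\<bar>)" using S(1) that by (intro member_le_sum) auto
    then show ?thesis unfolding N_def by linarith
  qed
  have N0: "N > 0" by (simp add: N_def)
  define t where "t j = cis (2 * pi * real j / real N)" for j
  have t: "norm (t j) = 1" for j by (simp add: t_def)
  have tp: "t j powi m * t j powi (-k) = cis (2 * pi * real_of_int (m - k) * real j / real N)" for j m
    by (simp add: t_def cis_power_int cis_mult) (simp add: divide_simps algebra_simps)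
  have "(\<Sum>j<N. p (t j) * t j powi (-k)) = (\<Sum>j<N. \<Sum>m\<in>S. c m * (t j powi m * t j powi (-k)))"
    by (simp add: p[OF t] sum_distrib_right mult.assoc)
  also have "\<dots> = (\<Sum>m\<in>S. c m * (\<Sum>j<N. cis (2 * pi * real_of_int (m - k) * real j / real N)))"
    unfolding tp sum_distrib_left by (rule sum.swap)
  also have "\<dots> = (\<Sum>m\<in>S. if m = k then c k * of_nat N else 0)"
  proof (rule sum.cong[OF refl])
    fix m assume m: "m \<in> S"
    show "c m * (\<Sum>j<N. cis (2 * pi * real_of_int (m - k) * real j / real N))
        = (if m = k then c k * of_nat N else 0)"
      using sum_roots_of_unity[of "m - k" N] N[OF m] by (cases "m = k") auto
  qed
  also have "\<dots> = c k * of_nat N" using S by simp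
  finally have "norm (c k) * real N = norm (\<Sum>j<N. p (t j) * t j powi (-k))"
    by (simp add: norm_mult)
  also have "\<dots> \<le> (\<Sum>j<N. B)"
    by (rule sum_norm_le) (simp add: norm_mult norm_circle_powi t B)
  finally show ?thesis using N0 by (simp add: mult.commute)
qed

text \<open>
  In the converse direction of \<open>wiener_le_norm\<close> there is no bound for general functions; for Laurent
  polynomials the price is the number of coefficients.
\<close>

lemma wiener_le_laurent_poly:
  assumes p: "laurent_poly d p" and B: "\<And>t. norm t = 1 \<Longrightarrow> norm (p t) \<le> B"
  shows "wiener_le p (real (2 * d + 1) * B)"
proof -
  obtain c where c: "\<And>t. norm t = 1 \<Longrightarrow> p t = (\<Sum>k\<in>{-int d..int d}. c k * t powi k)"
    using p unfolding laurent_poly_def by blast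
  have "wiener_le (\<lambda>t. \<Sum>k\<in>{-int d..int d}. c k * t powi k) (\<Sum>k\<in>{-int d..int d}. norm (c k))"
    by (intro wiener_le_sum wiener_le_monom) auto
  moreover have "(\<Sum>k\<in>{-int d..int d}. norm (c k)) \<le> (\<Sum>k\<in>{-int d..int d}. B)"
    by (intro sum_mono laurent_coeff_bound[OF c B]) auto
  moreover have "(\<Sum>k\<in>{-int d..int d}. B) = real (2 * d + 1) * B"
    by (simp add: nat_add_distrib nat_mult_distrib)
  ultimately show ?thesis
    by (metis (no_types, lifting) c wiener_le_mono wiener_le_cong)
qed

text \<open>
  Uniqueness of the coefficients. A partial sum \<open>p\<close> containing the \<open>k\<close>-th term is uniformly as small
  as the tail that it omits, hence so is its coefficient.
\<close>

lemma laurent_coeff_zero: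
  fixes c :: "int \<Rightarrow> complex"
  assumes abs: "(\<lambda>k. norm (c k)) summable_on UNIV"
    and 0: "\<And>t. norm t = 1 \<Longrightarrow> ((\<lambda>k. c k * t powi k) has_sum 0) UNIV"
  shows "c k = 0"
proof (rule ccontr)
  assume "c k \<noteq> 0"
  \<comment> \<open>The bound \<open>norm (c k) \<le> \<epsilon>\<close> derived below contradicts \<open>0 < norm (c k)\<close>.\<close>
  define \<epsilon> where "\<epsilon> = norm (c k) / 2"
  have \<epsilon>: "\<epsilon> > 0" using \<open>c k \<noteq> 0\<close> by (simp add: \<epsilon>_def)
  obtain F where F: "finite F" "dist (\<Sum>k\<in>F. norm (c k)) (\<Sum>\<^sub>\<infinity>k. norm (c k)) \<le> \<epsilon>"
    using infsum_finite_approximation[OF abs \<epsilon>] by blast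
  define G where "G = insert k F"
  have G: "finite G" using F(1) by (simp add: G_def)
  have tail: "((\<lambda>k. norm (c k)) has_sum (\<Sum>\<^sub>\<infinity>k. norm (c k)) - (\<Sum>k\<in>G. norm (c k))) (UNIV - G)"
    using has_sum_Diff[OF has_sum_infsum[OF abs] has_sum_finite[OF G]] by simp
  have "(\<Sum>k\<in>F. norm (c k)) \<le> (\<Sum>k\<in>G. norm (c k))"
    using G by (intro sum_mono2) (auto simp: G_def)
  then have tail_le: "(\<Sum>\<^sub>\<infinity>k. norm (c k)) - (\<Sum>k\<in>G. norm (c k)) \<le> \<epsilon>"
    using F(2) by (simp add: dist_real_def)
  have "norm (\<Sum>k\<in>G. c k * t powi k) \<le> \<epsilon>" if t: "norm t = 1" for t
  proof -
    have "((\<lambda>k. c k * t powi k) has_sum 0 - (\<Sum>k\<in>G. c k * t powi k)) (UNIV - G)"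
      using has_sum_Diff[OF 0[OF t] has_sum_finite[OF G]] by simp
    from norm_infsum_le[OF this tail]
    have "norm (0 - (\<Sum>k\<in>G. c k * t powi k)) \<le> (\<Sum>\<^sub>\<infinity>k. norm (c k)) - (\<Sum>k\<in>G. norm (c k))"
      by (simp add: norm_mult norm_circle_powi[OF t])
    with tail_le show ?thesis by simp
  qed
  from laurent_coeff_bound[OF refl this G, of k] have "norm (c k) \<le> \<epsilon>" by (simp add: G_def)
  then show False using \<epsilon> by (simp add: \<epsilon>_def)
qed

section \<open>Wiener's lemma\<close>

lemma wiener_le_approx:
  assumes "wiener_le f M" and "\<epsilon> > 0"
  obtains d p where "laurent_poly d p" and "wiener_le (\<lambda>t. f t - p t) \<epsilon>"
proof -
  obtain c :: "int \<Rightarrow> complex" where c: "(\<lambda>k. norm (c k)) summable_on UNIV"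
    "\<And>t. norm t = 1 \<Longrightarrow> ((\<lambda>k. c k * t powi k) has_sum f t) UNIV"
    using assms(1) unfolding wiener_le_def by blast
  obtain F where F: "finite F" "dist (\<Sum>k\<in>F. norm (c k)) (\<Sum>\<^sub>\<infinity>k. norm (c k)) \<le> \<epsilon>"
    using infsum_finite_approximation[OF c(1) assms(2)] by blast
  define d where "d = (\<Sum>k\<in>F. nat \<bar>k\<bar>)"
  define p where "p t = (\<Sum>k\<in>F. c k * t powi k)" for t
  have "F \<subseteq> {-int d..int d}"
  proof
    fix k assume "k \<in> F"
    then have "nat \<bar>k\<bar> \<le> d" unfolding d_def using F(1) by (intro member_le_sum) auto
    then show "k \<in> {-int d..int d}" by auto
  qed
  then have "p t = (\<Sum>k\<in>{-int d..int d}. (if k \<in> F then c k else 0) * t powi k)" for t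
    unfolding p_def by (intro sum.mono_neutral_cong_left) auto
  then have 1: "laurent_poly d p" unfolding laurent_poly_def by (metis (no_types))
  have tail: "((\<lambda>k. norm (c k)) has_sum (\<Sum>\<^sub>\<infinity>k. norm (c k)) - (\<Sum>k\<in>F. norm (c k))) (UNIV - F)"
    using has_sum_Diff[OF has_sum_infsum[OF c(1)] has_sum_finite[OF F(1)]] by simp
  have "wiener_le (\<lambda>t. f t - p t) (infsum (\<lambda>k. norm (c k)) (UNIV - F))"
  proof (rule wiener_le_has_sum)
    show "wiener_le (\<lambda>t. c k * t powi k) (norm (c k))" for k by (rule wiener_le_monom)
    show "(\<lambda>k. norm (c k)) summable_on UNIV - F" using has_sum_imp_summable[OF tail] .
    show "((\<lambda>k. c k * t powi k) has_sum f t - p t) (UNIV - F)" if "norm t = 1" for t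
      using has_sum_Diff[OF c(2)[OF that] has_sum_finite[OF F(1)]] by (simp add: p_def)
  qed
  moreover have "infsum (\<lambda>k. norm (c k)) (UNIV - F) \<le> \<epsilon>"
    using F(2) by (simp add: infsumI[OF tail] dist_real_def)
  ultimately have 2: "wiener_le (\<lambda>t. f t - p t) \<epsilon>" by (rule wiener_le_mono)
  show ?thesis using that 1 2 by blast
qed

text \<open>
  The hypothesis bounds \<open>h\<close> only in supremum norm, so the Neumann series is not summable by the
  triangle inequality alone. The binomial expansion of \<open>(p + (h - p))^n\<close> separates a Laurent
  polynomial \<open>p\<close>, whose powers are controlled by the supremum norm up to a factor linear in \<open>n\<close>,
  from a remainder that is small in the Wiener norm.
\<close>

lemma wiener_inverse_one_minus:
  assumes h: "wiener_le h M" and r: "r < 1" "\<And>t. norm t = 1 \<Longrightarrow> norm (h t) \<le> r"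
  shows "\<exists>N. wiener_le (\<lambda>t. 1 / (1 - h t)) N"
proof -
  \<comment> \<open>The errors of size \<open>\<delta>\<close> in \<open>p\<close> and in the remainder add up to a rate \<open>q = r + 2 \<delta>\<close>
    that is still below \<open>1\<close>.\<close>
  define \<delta> where "\<delta> = (1 - r) / 3"
  have r0: "0 \<le> r" using r(2)[of 1] norm_ge_zero[of "h 1"] by (simp del: norm_ge_zero)
  have \<delta>: "\<delta> > 0" using r by (simp add: \<delta>_def)
  define q where "q = r + \<delta> + \<delta>"
  have q: "0 \<le> q" "q < 1" using r(1) r0 by (auto simp: q_def \<delta>_def field_simps)
  obtain d p where p: "laurent_poly d p" and e: "wiener_le (\<lambda>t. h t - p t) \<delta>"
    using wiener_le_approx[OF h \<delta>] .
  have pb: "norm (p t) \<le> r + \<delta>" if "norm t = 1" for t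
    using r(2)[OF that] wiener_le_norm[OF e that] norm_triangle_ineq4[of "h t" "h t - p t"] by simp
  have pow: "wiener_le (\<lambda>t. h t ^ n) (real (2 * (n * d) + 1) * q ^ n)" for n
  proof -
    have "wiener_le (\<lambda>t. \<Sum>j\<le>n. of_nat (n choose j) * (p t ^ j * (h t - p t) ^ (n - j)))
       (\<Sum>j\<le>n. real (n choose j) * (real (2 * (j * d) + 1) * (r + \<delta>) ^ j * \<delta> ^ (n - j)))"
    proof (intro wiener_le_sum wiener_le_mult)
      show "wiener_le (\<lambda>t. of_nat (n choose j)) (real (n choose j))" for j
        using wiener_le_const[of "of_nat (n choose j)"] by simp
      show "wiener_le (\<lambda>t. p t ^ j) (real (2 * (j * d) + 1) * (r + \<delta>) ^ j)" for j
        by (rule wiener_le_laurent_poly[OF laurent_poly_power[OF p]])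
          (auto simp: norm_power intro!: power_mono pb)
      show "wiener_le (\<lambda>t. (h t - p t) ^ (n - j)) (\<delta> ^ (n - j))" for j
        by (rule wiener_le_power[OF e])
    qed simp
    then have "wiener_le (\<lambda>t. h t ^ n)
       (\<Sum>j\<le>n. real (n choose j) * (real (2 * (j * d) + 1) * (r + \<delta>) ^ j * \<delta> ^ (n - j)))"
    proof (rule wiener_le_cong)
      fix t
      show "(\<Sum>j\<le>n. of_nat (n choose j) * (p t ^ j * (h t - p t) ^ (n - j))) = h t ^ n"
        using binomial_ring[of "p t" "h t - p t" n] by (simp add: mult.assoc)
    qed
    moreover have "(\<Sum>j\<le>n. real (n choose j) * (real (2 * (j * d) + 1) * (r + \<delta>) ^ j * \<delta> ^ (n - j)))
      \<le> (\<Sum>j\<le>n. real (2 * (n * d) + 1) * (real (n choose j) * (r + \<delta>) ^ j * \<delta> ^ (n - j)))"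
    proof (rule sum_mono)
      fix j assume "j \<in> {..n}"
      then have "real (2 * (j * d) + 1) \<le> real (2 * (n * d) + 1)"
        unfolding of_nat_le_iff by (intro add_mono mult_mono) auto
      moreover have "0 \<le> real (n choose j) * ((r + \<delta>) ^ j * \<delta> ^ (n - j))"
        using r0 \<delta> by simp
      ultimately have "real (2 * (j * d) + 1) * (real (n choose j) * ((r + \<delta>) ^ j * \<delta> ^ (n - j)))
        \<le> real (2 * (n * d) + 1) * (real (n choose j) * ((r + \<delta>) ^ j * \<delta> ^ (n - j)))"
        by (rule mult_right_mono)
      then show "real (n choose j) * (real (2 * (j * d) + 1) * (r + \<delta>) ^ j * \<delta> ^ (n - j))
        \<le> real (2 * (n * d) + 1) * (real (n choose j) * (r + \<delta>) ^ j * \<delta> ^ (n - j))"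
        by (simp only: mult_ac)
    qed
    moreover have "\<dots> = real (2 * (n * d) + 1) * q ^ n"
      unfolding q_def binomial_ring[of "r + \<delta>" \<delta> n] sum_distrib_left ..
    ultimately show ?thesis by (metis (no_types, lifting) wiener_le_mono)
  qed
  have sm: "summable (\<lambda>n. real (2 * (n * d) + 1) * q ^ n)"
  proof (rule summable_comparison_test')
    have "summable (\<lambda>n. of_nat (Suc n) * q ^ n)"
      using geometric_deriv_sums[of q] q sums_summable by auto
    then show "summable (\<lambda>n. real (2 * d + 1) * (of_nat (Suc n) * q ^ n))"
      by (rule summable_mult)
    fix n :: nat
    have "real (2 * (n * d) + 1) \<le> real (2 * d + 1) * real (Suc n)"
      unfolding of_nat_mult[symmetric] of_nat_le_iff by (simp add: algebra_simps)
    then have "real (2 * (n * d) + 1) * q ^ n \<le> real (2 * d + 1) * real (Suc n) * q ^ n"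
      using q by (intro mult_right_mono) auto
    then show "norm (real (2 * (n * d) + 1) * q ^ n) \<le> real (2 * d + 1) * (of_nat (Suc n) * q ^ n)"
      using q by (simp add: mult.assoc abs_mult)
  qed
  have "wiener_le (\<lambda>t. 1 / (1 - h t)) (\<Sum>\<^sub>\<infinity>n. real (2 * (n * d) + 1) * q ^ n)"
  proof (rule wiener_le_has_sum[OF pow])
    show "(\<lambda>n. real (2 * (n * d) + 1) * q ^ n) summable_on UNIV"
      using q by (intro summable_nonneg_imp_summable_on sm) auto
    fix t :: complex assume "norm t = 1"
    then have "norm (h t) < 1" using r by fastforce
    then show "((\<lambda>n. h t ^ n) has_sum 1 / (1 - h t)) UNIV"
      by (intro norm_summable_imp_has_sum geometric_sums) (simp_all add: norm_power summable_geometric)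
  qed
  then show ?thesis by blast
qed

definition wiener :: "(complex \<Rightarrow> complex) \<Rightarrow> bool" where
  "wiener f \<longleftrightarrow> (\<exists>M. wiener_le f M)"

text \<open>
  By the Weierstrass M-test. Continuity on the compact circle is what bounds a nowhere vanishing
  function away from zero.
\<close>

lemma wiener_continuous:
  assumes "wiener f"
  shows "continuous_on (sphere 0 1) f"
proof -
  obtain c :: "int \<Rightarrow> complex" where c: "(\<lambda>k. norm (c k)) summable_on UNIV"
    "\<And>t. norm t = 1 \<Longrightarrow> ((\<lambda>k. c k * t powi k) has_sum f t) UNIV"
    using assms unfolding wiener_def wiener_le_def by blast
  have "uniform_limit (sphere 0 1) (\<lambda>X t. \<Sum>k\<in>X. c k * t powi k) f (finite_subsets_at_top UNIV)"
    by (rule Weierstrass_m_test_general'[OF _ _ c(1)]) (auto simp: norm_mult norm_circle_powi c(2))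
  then show ?thesis
    by (rule uniform_limit_theorem[rotated])
      (auto intro!: always_eventually continuous_intros)
qed

text \<open>
  Wiener's lemma. The identity \<open>1 / f = cnj f / |f|\<^sup>2\<close> reduces it to the positive function
  \<open>|f|\<^sup>2\<close>, which after scaling by \<open>M\<^sup>2\<close> takes values in a compact subinterval of \<open>(0, 1]\<close>.
\<close>

lemma wiener_inverse:
  assumes f: "wiener f" and nz: "\<And>t. norm t = 1 \<Longrightarrow> f t \<noteq> 0"
  shows "wiener (\<lambda>t. 1 / f t)"
proof -
  obtain M where M: "wiener_le f M" using f unfolding wiener_def by blast
  have "\<exists>s\<in>sphere 0 1. \<forall>t\<in>sphere 0 1. norm (f s) \<le> norm (f t)"
    by (rule continuous_attains_inf) (auto intro!: continuous_on_norm wiener_continuous f)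
  then obtain s where s: "norm s = 1" "\<And>t. norm t = 1 \<Longrightarrow> norm (f s) \<le> norm (f t)" by auto
  define m where "m = norm (f s)"
  have m: "0 < m" "m \<le> M" using nz[OF s(1)] wiener_le_norm[OF M s(1)] by (auto simp: m_def)
  define h where "h t = 1 - f t * cnj (f t) / of_real (M\<^sup>2)" for t
  define r where "r = 1 - m\<^sup>2 / M\<^sup>2"
  have h_eq: "h t = of_real (1 - (norm (f t))\<^sup>2 / M\<^sup>2)" for t
    unfolding h_def complex_norm_square[symmetric] by simp
  have hr: "norm (h t) \<le> r" if "norm t = 1" for t
  proof -
    have "m\<^sup>2 \<le> (norm (f t))\<^sup>2" "(norm (f t))\<^sup>2 \<le> M\<^sup>2"
      using s(2)[OF that] wiener_le_norm[OF M that] m by (auto simp: m_def intro!: power_mono)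
    then have "m\<^sup>2 / M\<^sup>2 \<le> (norm (f t))\<^sup>2 / M\<^sup>2" "(norm (f t))\<^sup>2 / M\<^sup>2 \<le> 1"
      using m by (auto simp: divide_simps)
    then show ?thesis unfolding h_eq norm_of_real r_def by simp
  qed
  have "wiener_le (\<lambda>t. 1 + of_real (- 1 / M\<^sup>2) * (f t * cnj (f t)))
      (norm (1::complex) + norm (of_real (- 1 / M\<^sup>2) :: complex) * (M * M))"
    by (intro wiener_le_add wiener_le_mult wiener_le_const wiener_le_cnj M)
  then have "wiener_le h (norm (1::complex) + norm (of_real (- 1 / M\<^sup>2) :: complex) * (M * M))"
    by (rule wiener_le_cong) (simp add: h_def)
  moreover have "r < 1" using m by (simp add: r_def)
  ultimately obtain N where N: "wiener_le (\<lambda>t. 1 / (1 - h t)) N"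
    using wiener_inverse_one_minus hr by blast
  have "wiener_le (\<lambda>t. of_real (1 / M\<^sup>2) * (cnj (f t) * (1 / (1 - h t))))
     (norm (of_real (1 / M\<^sup>2) :: complex) * (M * N))"
    by (intro wiener_le_mult wiener_le_const wiener_le_cnj M N)
  then have "wiener_le (\<lambda>t. 1 / f t) (norm (of_real (1 / M\<^sup>2) :: complex) * (M * N))"
    by (rule wiener_le_cong) (use nz m in \<open>auto simp: h_def field_simps\<close>)
  then show ?thesis unfolding wiener_def by blast
qed

lemma wiener_const: "wiener (\<lambda>t. a)"
  unfolding wiener_def using wiener_le_const by blast

lemma wiener_add: "wiener f \<Longrightarrow> wiener g \<Longrightarrow> wiener (\<lambda>t. f t + g t)"
  unfolding wiener_def using wiener_le_add by blast

lemma wiener_mult: "wiener f \<Longrightarrow> wiener g \<Longrightarrow> wiener (\<lambda>t. f t * g t)"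
  unfolding wiener_def using wiener_le_mult by blast

lemma wiener_diff: 
  assumes "wiener f" and "wiener g"
  shows "wiener (\<lambda>t. f t - g t)"
  using wiener_add[OF assms(1) wiener_mult[OF wiener_const[of "-1"] assms(2)]] by simp

lemma wiener_divide:
  assumes "wiener f" and "wiener g" and "\<And>t. norm t = 1 \<Longrightarrow> g t \<noteq> 0"
  shows "wiener (\<lambda>t. f t / g t)"
  using wiener_mult[OF assms(1) wiener_inverse[OF assms(2,3)]] by simp

lemma wiener_sum:
  assumes "\<And>i. i \<in> S \<Longrightarrow> wiener (f i)"
  shows "wiener (\<lambda>t. \<Sum>i\<in>S. f i t)"
  using assms by (induction S rule: infinite_finite_induct) (simp_all add: wiener_const wiener_add)

section \<open>Linear systems with absolutely convergent coefficients\<close>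

definition sesq_form :: "'x set \<Rightarrow> ('x \<Rightarrow> 'x \<Rightarrow> complex) \<Rightarrow> ('x \<Rightarrow> complex) \<Rightarrow> complex" where
  "sesq_form S A \<xi> = (\<Sum>x\<in>S. cnj (\<xi> x) * (\<Sum>y\<in>S. A x y * \<xi> y))"

text \<open>
  Gaussian elimination on \<open>s\<close>. The nondegeneracy hypothesis, applied to a unit vector, says that
  the pivot has no zero on the circle, so Wiener's lemma permits division by it. It passes to the
  Schur complement \<open>B\<close>: a vector \<open>\<xi>\<close> on \<open>S\<close> extends to a vector \<open>\<eta>\<close> on \<open>insert s S\<close> for which
  the \<open>s\<close>-th entry of \<open>A \<eta>\<close> vanishes and the others are those of \<open>B \<xi>\<close>, so both forms take the
  same value. Unlike the invertibility of the matrices, this condition needs no choice of pivots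
  depending on \<open>t\<close>.
\<close>

lemma wiener_solve:
  fixes A :: "'x \<Rightarrow> 'x \<Rightarrow> complex \<Rightarrow> complex" and g :: "'x \<Rightarrow> complex \<Rightarrow> complex"
  assumes "finite S"
    and "\<And>x y. wiener (A x y)" and "\<And>x. wiener (g x)"
    and "\<And>t \<xi>. norm t = 1 \<Longrightarrow> sesq_form S (\<lambda>x y. A x y t) \<xi> = 0 \<Longrightarrow> \<forall>x\<in>S. \<xi> x = 0"
  shows "\<exists>u. (\<forall>x. wiener (u x)) \<and> (\<forall>t. norm t = 1 \<longrightarrow> (\<forall>x\<in>S. (\<Sum>y\<in>S. A x y t * u y t) = g x t))"
  using assms
proof (induction S arbitrary: A g rule: finite_induct)
  case empty
  then show ?case using wiener_const by (intro exI[of _ "\<lambda>_ _. 0"]) auto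
next
  case (insert s S A g)
  note A = insert.prems(1) and g = insert.prems(2) and nondeg = insert.prems(3)
  have piv: "A s s t \<noteq> 0" if t: "norm t = 1" for t
  proof
    assume "A s s t = 0"
    moreover have "(\<Sum>y\<in>S. A s y t * (if y = s then 1 else 0)) = 0"
      "(\<Sum>x\<in>S. cnj (if x = s then 1 else 0) * (A x s t + (\<Sum>y\<in>S. A x y t * (if y = s then 1 else 0)))) = 0"
      using insert.hyps by (auto intro!: sum.neutral)
    ultimately have "sesq_form (insert s S) (\<lambda>x y. A x y t) (\<lambda>x. if x = s then 1 else 0) = 0"
      using insert.hyps by (simp add: sesq_form_def)
    from nondeg[OF t this] show False by simp
  qed
  define B where "B x y t = A x y t - A x s t * (A s y t / A s s t)" for x y t
  define h where "h x t = g x t - A x s t * (g s t / A s s t)" for x t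
  have row: "(\<Sum>y\<in>insert s S. A x y t * (if y = s then (b - (\<Sum>z\<in>S. A s z t * v z)) / A s s t else v y))
      = A x s t * (b / A s s t) + (\<Sum>y\<in>S. B x y t * v y)" for x t b v
  proof -
    have "(\<Sum>y\<in>S. A x y t * (if y = s then (b - (\<Sum>z\<in>S. A s z t * v z)) / A s s t else v y))
        = (\<Sum>y\<in>S. A x y t * v y)"
      using insert.hyps by (intro sum.cong) auto
    then show ?thesis
      using insert.hyps
      by (simp add: B_def diff_divide_distrib sum_subtractf sum_distrib_left sum_divide_distrib algebra_simps)
  qed
  have row_s: "(\<Sum>y\<in>S. B s y t * v y) = 0" if t: "norm t = 1" for t v
    using piv[OF t] by (simp add: B_def)
  have "\<exists>u. (\<forall>x. wiener (u x)) \<and> (\<forall>t. norm t = 1 \<longrightarrow> (\<forall>x\<in>S. (\<Sum>y\<in>S. B x y t * u y t) = h x t))"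
  proof (rule insert.IH)
    show "wiener (B x y)" for x y
      unfolding B_def by (intro wiener_diff wiener_mult wiener_divide A piv)
    show "wiener (h x)" for x
      unfolding h_def by (intro wiener_diff wiener_mult wiener_divide A g piv)
  next
    fix t \<xi> assume t: "norm t = 1" and 0: "sesq_form S (\<lambda>x y. B x y t) \<xi> = 0"
    \<comment> \<open>The value at \<open>s\<close> solves the \<open>s\<close>-th equation of the homogeneous system.\<close>
    define \<eta> where "\<eta> y = (if y = s then (0 - (\<Sum>z\<in>S. A s z t * \<xi> z)) / A s s t else \<xi> y)" for y
    have "sesq_form (insert s S) (\<lambda>x y. A x y t) \<eta> = (\<Sum>x\<in>insert s S. cnj (\<eta> x) * (\<Sum>y\<in>S. B x y t * \<xi> y))"
      unfolding sesq_form_def by (rule sum.cong[OF refl]) (simp only: \<eta>_def row, simp)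
    also have "\<dots> = (\<Sum>x\<in>S. cnj (\<eta> x) * (\<Sum>y\<in>S. B x y t * \<xi> y))"
      using insert.hyps row_s[OF t] by simp
    also have "\<dots> = sesq_form S (\<lambda>x y. B x y t) \<xi>"
      unfolding sesq_form_def using insert.hyps by (intro sum.cong) (auto simp: \<eta>_def)
    finally have "sesq_form (insert s S) (\<lambda>x y. A x y t) \<eta> = 0" using 0 by simp
    from nondeg[OF t this] show "\<forall>x\<in>S. \<xi> x = 0"
      using insert.hyps by (auto simp: \<eta>_def split: if_splits)
  qed
  then obtain v where v: "\<And>x. wiener (v x)"
    "\<And>t x. norm t = 1 \<Longrightarrow> x \<in> S \<Longrightarrow> (\<Sum>y\<in>S. B x y t * v y t) = h x t" by blast
  \<comment> \<open>Back substitution.\<close>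
  define u where "u y t = (if y = s then (g s t - (\<Sum>z\<in>S. A s z t * v z t)) / A s s t else v y t)" for y t
  have "wiener (u y)" for y
    by (cases "y = s")
      (auto simp: u_def[abs_def] intro!: wiener_divide wiener_diff wiener_sum wiener_mult A g v piv)
  moreover have "(\<Sum>y\<in>insert s S. A x y t * u y t) = g x t" if t: "norm t = 1" and x: "x \<in> insert s S" for x t
  proof -
    have "(\<Sum>y\<in>insert s S. A x y t * u y t) = A x s t * (g s t / A s s t) + (\<Sum>y\<in>S. B x y t * v y t)"
      unfolding u_def by (rule row)
    then show ?thesis
      using x row_s[OF t] v(2)[OF t] piv[OF t] by (cases "x = s") (auto simp: h_def)
  qed
  ultimately show ?case by blast
qed

lemma sesq_hermitian_real:
  assumes "\<And>x y. cnj (A x y) = A y x"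
  shows "sesq_form S A \<xi> \<in> \<real>"
proof -
  have "cnj (sesq_form S A \<xi>) = (\<Sum>x\<in>S. \<Sum>y\<in>S. \<xi> x * (A y x * cnj (\<xi> y)))"
    by (simp add: sesq_form_def assms sum_distrib_left)
  also have "\<dots> = (\<Sum>y\<in>S. \<Sum>x\<in>S. \<xi> x * (A y x * cnj (\<xi> y)))" by (rule sum.swap)
  also have "\<dots> = sesq_form S A \<xi>" by (simp add: sesq_form_def sum_distrib_left mult_ac)
  finally show ?thesis by (simp add: Reals_cnj_iff)
qed

section \<open>Integer iterates of a bijection\<close>

lemma iterate_0 [simp]: "iterate f 0 x = x"
  by (simp add: iterate_def)

lemma iterate_plus_1:
  assumes "bij f"
  shows "iterate f (k + 1) x = f (iterate f k x)"
proof (cases "k \<ge> 0")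
  case True
  then show ?thesis by (simp add: iterate_def nat_add_distrib)
next
  case False
  define n where "n = nat (- (k + 1))"
  have k: "k = - int n - 1" using False by (simp add: n_def)
  have "iterate f (k + 1) x = (inv_into UNIV f ^^ n) x"
    by (cases n) (simp_all add: iterate_def k nat_add_distrib)
  moreover have "iterate f k x = (inv_into UNIV f ^^ Suc n) x"
    by (simp add: iterate_def k nat_add_distrib)
  ultimately show ?thesis using assms by (simp add: bij_is_surj surj_f_inv_f)
qed

lemma iterate_add:
  assumes "bij f"
  shows "iterate f (j + k) x = iterate f j (iterate f k x)"
proof (induction j rule: int_induct[where k = 0])
  case base
  then show ?case by simp
next
  case (step1 j)
  then show ?case
    using iterate_plus_1[OF assms, of "j + k" x] iterate_plus_1[OF assms, of j "iterate f k x"]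
    by (simp add: algebra_simps)
next
  case (step2 j)
  have "f (iterate f (j - 1 + k) x) = f (iterate f (j - 1) (iterate f k x))"
    using step2 iterate_plus_1[OF assms, of "j - 1 + k" x] iterate_plus_1[OF assms, of "j - 1" "iterate f k x"]
    by (simp add: algebra_simps)
  then show ?case using assms by (simp add: bij_is_inj inj_eq)
qed

section \<open>Dynamical systems on finitely many points\<close>

locale finite_system =
  fixes \<sigma> \<tau> :: "'x::t2_space \<Rightarrow> 'x"
  assumes homeo: "homeomorphism UNIV UNIV \<sigma> \<tau>"
    and fin: "finite (UNIV :: 'x set)"
begin

lemma bij_sigma: "bij \<sigma>"
  using homeo by (metis bijI' homeomorphism_def UNIV_I)

lemma inv_sigma: "inv_into UNIV \<sigma> = \<tau>"
  using homeo by (intro inv_equality) (auto simp: homeomorphism_def)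

abbreviation act :: "int \<Rightarrow> 'x \<Rightarrow> 'x" where "act \<equiv> iterate \<sigma>"

lemma act_add: "act (j + k) x = act j (act k x)"
  by (rule iterate_add[OF bij_sigma])

lemma bij_cfun_auto: "bij (cfun_auto \<sigma>)"
proof -
  have t: "homeomorphism UNIV UNIV \<tau> \<sigma>" using homeo by (rule homeomorphism_symD)
  have inv_t: "inv_into UNIV \<tau> = \<sigma>"
    using t by (intro inv_equality) (auto simp: homeomorphism_def)
  have "\<tau> (\<sigma> x) = x" "\<sigma> (\<tau> x) = x" for x using homeo by (auto simp: homeomorphism_def)
  then have "cfun_auto \<tau> (cfun_auto \<sigma> f) = f" "cfun_auto \<sigma> (cfun_auto \<tau> f) = f" for f
    by (auto intro!: bcontfun_eqI simp: apply_cfun_auto[OF homeo] apply_cfun_auto[OF t] inv_sigma inv_t)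
  then show ?thesis by (intro bij_betw_byWitness[of _ "cfun_auto \<tau>"]) auto
qed

text \<open>
  The induction runs downwards as well as upwards from \<open>0\<close>; in the downward step \<open>cfun_auto \<sigma>\<close> is
  cancelled by evaluating at \<open>\<sigma> x\<close>.
\<close>

lemma apply_iterate_cfun_auto:
  "apply_bcontfun (iterate (cfun_auto \<sigma>) k f) x = apply_bcontfun f (act (- k) x)"
proof (induction k arbitrary: x rule: int_induct[where k = 0])
  case base
  then show ?case by simp
next
  case (step1 k)
  have "inv_into UNIV \<sigma> x = act (-1) x" by (simp add: iterate_def)
  then have "act (- k) (inv_into UNIV \<sigma> x) = act (- (k + 1)) x"
    using act_add[of "-k" "-1" x] by simp
  then show ?case
    by (simp add: iterate_plus_1[OF bij_cfun_auto] apply_cfun_auto[OF homeo] step1)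
next
  case (step2 k)
  have "inv_into UNIV \<sigma> (\<sigma> x) = x" using bij_sigma by (simp add: bij_is_inj)
  then have "apply_bcontfun (iterate (cfun_auto \<sigma>) (k - 1) f) x
      = apply_bcontfun (cfun_auto \<sigma> (iterate (cfun_auto \<sigma>) (k - 1) f)) (\<sigma> x)"
    by (simp add: apply_cfun_auto[OF homeo])
  also have "\<dots> = apply_bcontfun f (act (- k) (\<sigma> x))"
    using step2 iterate_plus_1[OF bij_cfun_auto, of "k - 1" f] by simp
  also have "\<sigma> x = act 1 x" using iterate_plus_1[OF bij_sigma, of 0 x] by simp
  also have "act (- k) (act 1 x) = act (- (k - 1)) x" using act_add[of "-k" 1 x] by simp
  finally show ?case .
qed

lemma apply_Bcontfun: "apply_bcontfun (Bcontfun F) x = F x" for F :: "'x \<Rightarrow> complex"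
proof -
  have "continuous_on UNIV F" using fin by (rule continuous_on_finite)
  moreover have "bounded (range F)" using fin by (intro finite_imp_bounded finite_imageI)
  ultimately show ?thesis by (simp add: Bcontfun_inverse bcontfun_def)
qed

lemma norm_le_sum_values: "norm f \<le> (\<Sum>x\<in>UNIV. norm (apply_bcontfun f x))" for f :: "'x cfun"
  by (rule norm_bound) (auto intro!: member_le_sum fin)

text \<open>
  Over finitely many points the supremum norm is equivalent to the sum of the moduli of the values,
  so membership in the algebra can be tested at each point separately.
\<close>

lemma norm_summable_iff:
  fixes a :: "'i \<Rightarrow> 'x cfun"
  shows "(\<lambda>k. norm (a k)) summable_on A \<longleftrightarrow> (\<forall>x. (\<lambda>k. norm (apply_bcontfun (a k) x)) summable_on A)"
proof (intro iffI allI)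
  fix x assume "(\<lambda>k. norm (a k)) summable_on A"
  then show "(\<lambda>k. norm (apply_bcontfun (a k) x)) summable_on A"
    by (rule Infinite_Sum.abs_summable_on_comparison_test') (rule norm_bounded)
next
  assume *: "\<forall>x. (\<lambda>k. norm (apply_bcontfun (a k) x)) summable_on A"
  have "finite S \<Longrightarrow> (\<lambda>k. \<Sum>x\<in>S. norm (apply_bcontfun (a k) x)) summable_on A" for S
    by (induction S rule: finite_induct) (use * in \<open>auto intro: summable_on_add\<close>)
  from this[OF fin] show "(\<lambda>k. norm (a k)) summable_on A"
    by (rule Infinite_Sum.abs_summable_on_comparison_test') (rule norm_le_sum_values)
qed

lemma apply_sum: "apply_bcontfun (sum a F) x = (\<Sum>k\<in>F. apply_bcontfun (a k) x)"
  for a :: "'i \<Rightarrow> 'x cfun"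
  by (induction F rule: infinite_finite_induct) auto

text \<open>
  Since there are finitely many points, pointwise convergence is convergence in the supremum norm;
  so the sums in the algebra can be computed pointwise.
\<close>

lemma apply_infsum:
  fixes a :: "'i \<Rightarrow> 'x cfun"
  assumes "\<And>x. (\<lambda>k. apply_bcontfun (a k) x) summable_on A"
  shows "apply_bcontfun (infsum a A) x = infsum (\<lambda>k. apply_bcontfun (a k) x) A"
proof -
  define s where "s = Bcontfun (\<lambda>x. infsum (\<lambda>k. apply_bcontfun (a k) x) A)"
  have s: "apply_bcontfun s x = infsum (\<lambda>k. apply_bcontfun (a k) x) A" for x
    unfolding s_def by (rule apply_Bcontfun)
  have "(a has_sum s) A"
    unfolding has_sum_def tendsto_iff
  proof (intro allI impI)
    fix e :: real assume e: "e > 0"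
    have "\<forall>\<^sub>F F in finite_subsets_at_top A. \<forall>x\<in>UNIV. dist (apply_bcontfun (sum a F) x) (apply_bcontfun s x) < e / 2"
    proof (intro eventually_ball_finite fin ballI)
      fix x
      have "((\<lambda>k. apply_bcontfun (a k) x) has_sum apply_bcontfun s x) A"
        unfolding s using assms by simp
      then show "\<forall>\<^sub>F F in finite_subsets_at_top A. dist (apply_bcontfun (sum a F) x) (apply_bcontfun s x) < e / 2"
        using e unfolding has_sum_def tendsto_iff apply_sum by (meson half_gt_zero)
    qed
    then show "\<forall>\<^sub>F F in finite_subsets_at_top A. dist (sum a F) s < e"
    proof (rule eventually_mono)
      fix F assume "\<forall>x\<in>UNIV. dist (apply_bcontfun (sum a F) x) (apply_bcontfun s x) < e / 2"
      then have "dist (sum a F) s \<le> e / 2" by (intro dist_bound) (simp add: less_imp_le)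
      then show "dist (sum a F) s < e" using e by simp
    qed
  qed
  then show ?thesis by (simp add: infsumI s)
qed

section \<open>The product of the convolution algebra\<close>

abbreviation alg where "alg \<equiv> ell1 \<sigma>"

lemma carrier_iff: "a \<in> carrier alg \<longleftrightarrow> (\<lambda>k. norm (a k)) summable_on UNIV"
  by (simp add: ell1_def)

text \<open>
  Absolute summability over all pairs of indices justifies every interchange of sums below.
\<close>

lemma conv_norm_summable:
  assumes "a \<in> carrier alg" and "b \<in> carrier alg"
  shows "(\<lambda>(n,k). norm (a k) * norm (b (n - k))) summable_on UNIV \<times> UNIV"
proof -
  have bij': "bij_betw (\<lambda>n. n - k) UNIV UNIV" for k :: int
    by (rule bij_betwI[of _ _ _ "\<lambda>j. j + k"]) auto
  have "((\<lambda>n. norm (b n)) has_sum (\<Sum>\<^sub>\<infinity>n. norm (b n))) UNIV"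
    using assms(2) by (simp add: carrier_iff)
  then have "((\<lambda>n. norm (b (n - k))) has_sum (\<Sum>\<^sub>\<infinity>n. norm (b n))) UNIV" for k
    by (subst has_sum_reindex_bij_betw[OF bij'[of k], of "\<lambda>n. norm (b n)"])
  then have "(\<lambda>(k,n). norm (a k) * norm (b (n - k))) summable_on UNIV \<times> UNIV"
    using assms(1)
    by (intro summable_on_SigmaI[where g = "\<lambda>k. norm (a k) * (\<Sum>\<^sub>\<infinity>n. norm (b n))"])
      (auto simp: carrier_iff intro!: has_sum_cmult_right summable_on_cmult_left)
  then show ?thesis by (subst summable_on_swap) (simp add: case_prod_unfold)
qed

lemma conv_norm_summable_row:
  assumes "a \<in> carrier alg" and "b \<in> carrier alg"
  shows "(\<lambda>k. norm (a k) * norm (b (n - k))) summable_on UNIV"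
  using summable_on_SigmaD1[OF conv_norm_summable[OF assms]] by simp

lemma term_norm_le:
  "norm (apply_bcontfun (f::'x cfun) x * apply_bcontfun (g::'x cfun) y) \<le> norm f * norm g"
  unfolding norm_mult by (intro mult_mono norm_bounded) auto

lemma conv_term_summable:
  assumes "a \<in> carrier alg" and "b \<in> carrier alg"
  shows "(\<lambda>k. apply_bcontfun (a k) x * apply_bcontfun (b (n - k)) (act (- k) x)) summable_on UNIV"
  by (rule abs_summable_summable,
      rule Infinite_Sum.abs_summable_on_comparison_test'[OF conv_norm_summable_row[OF assms]])
    (rule term_norm_le)

lemma mult_apply:
  assumes "a \<in> carrier alg" and "b \<in> carrier alg"
  shows "apply_bcontfun ((a \<otimes>\<^bsub>alg\<^esub> b) n) x
    = (\<Sum>\<^sub>\<infinity>k. apply_bcontfun (a k) x * apply_bcontfun (b (n - k)) (act (- k) x))"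
proof -
  have "apply_bcontfun ((a \<otimes>\<^bsub>alg\<^esub> b) n) x
    = (\<Sum>\<^sub>\<infinity>k. apply_bcontfun (cfun_mult (a k) (iterate (cfun_auto \<sigma>) k (b (n - k)))) x)"
    unfolding ell1_def using conv_term_summable[OF assms]
    by (simp add: apply_infsum apply_cfun_mult apply_iterate_cfun_auto)
  then show ?thesis by (simp add: apply_cfun_mult apply_iterate_cfun_auto)
qed

lemma mult_closed:
  assumes "a \<in> carrier alg" and "b \<in> carrier alg"
  shows "a \<otimes>\<^bsub>alg\<^esub> b \<in> carrier alg"
proof -
  have "norm (apply_bcontfun ((a \<otimes>\<^bsub>alg\<^esub> b) n) x) \<le> (\<Sum>\<^sub>\<infinity>k. norm (a k) * norm (b (n - k)))" for n x
    unfolding mult_apply[OF assms]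
    by (rule norm_infsum_le[OF has_sum_infsum[OF conv_term_summable[OF assms]]
          has_sum_infsum[OF conv_norm_summable_row[OF assms]]]) (rule term_norm_le)
  then show ?thesis
    unfolding carrier_iff norm_summable_iff
    by (intro allI Infinite_Sum.abs_summable_on_comparison_test'[OF
          summable_on_Sigma_banach[OF conv_norm_summable[OF assms]]])
qed

text \<open>
  The one rearrangement of double series behind everything that follows: weights \<open>g n = t^n\<close> give
  the multiplicativity of the Fourier transform, and translates of the coefficients of a third
  element give associativity.
\<close>

lemma weighted_sum_mult:
  assumes ab: "a \<in> carrier alg" "b \<in> carrier alg" and g: "\<And>n. norm (g n) \<le> C"
  shows "(\<Sum>\<^sub>\<infinity>n. g n * apply_bcontfun ((a \<otimes>\<^bsub>alg\<^esub> b) n) x)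
    = (\<Sum>\<^sub>\<infinity>k. apply_bcontfun (a k) x * (\<Sum>\<^sub>\<infinity>m. g (k + m) * apply_bcontfun (b m) (act (- k) x)))"
proof -
  define h where "h n k = g n * (apply_bcontfun (a k) x * apply_bcontfun (b (n - k)) (act (- k) x))" for n k
  have "(\<lambda>(n,k). C * (norm (a k) * norm (b (n - k)))) summable_on UNIV \<times> UNIV"
    using summable_on_cmult_right[OF conv_norm_summable[OF ab], of C] by (simp add: case_prod_unfold)
  then have "(\<lambda>p. norm ((\<lambda>(n,k). h n k) p)) summable_on UNIV \<times> UNIV"
  proof (rule Infinite_Sum.abs_summable_on_comparison_test')
    fix p :: "int \<times> int"
    have "norm (h n k) \<le> C * (norm (a k) * norm (b (n - k)))" for n k
      unfolding h_def norm_mult[of "g n"]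
      using order_trans[OF norm_ge_zero g] by (intro mult_mono g term_norm_le) auto
    then show "norm ((\<lambda>(n,k). h n k) p) \<le> (case p of (n, k) \<Rightarrow> C * (norm (a k) * norm (b (n - k))))"
      by (simp add: case_prod_unfold)
  qed
  then have swap: "(\<Sum>\<^sub>\<infinity>n. \<Sum>\<^sub>\<infinity>k. h n k) = (\<Sum>\<^sub>\<infinity>k. \<Sum>\<^sub>\<infinity>n. h n k)"
    by (rule infsum_swap_banach[OF abs_summable_summable])
  have "(\<Sum>\<^sub>\<infinity>n. h n k) = apply_bcontfun (a k) x * (\<Sum>\<^sub>\<infinity>m. g (k + m) * apply_bcontfun (b m) (act (- k) x))" for k
  proof -
    have "bij_betw (\<lambda>m. k + m) UNIV UNIV"
      by (rule bij_betwI[of _ _ _ "\<lambda>j. j - k"]) auto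
    then have "(\<Sum>\<^sub>\<infinity>n. h n k) = (\<Sum>\<^sub>\<infinity>m. h (k + m) k)"
      by (rule infsum_reindex_bij_betw[symmetric])
    also have "\<dots> = (\<Sum>\<^sub>\<infinity>m. apply_bcontfun (a k) x * (g (k + m) * apply_bcontfun (b m) (act (- k) x)))"
      by (simp add: h_def mult.left_commute)
    finally show ?thesis by (simp only: infsum_cmult_right')
  qed
  then show ?thesis using swap by (simp add: mult_apply[OF ab] h_def infsum_cmult_right')
qed

lemma bounded_coeff:
  assumes "a \<in> carrier alg"
  shows "norm (apply_bcontfun (a n) x) \<le> (\<Sum>\<^sub>\<infinity>k. norm (a k))"
proof -
  have "norm (a n) \<le> (\<Sum>\<^sub>\<infinity>k. norm (a k))"
    using finite_sum_le_infsum[of "\<lambda>k. norm (a k)" UNIV "{n}"] assms by (simp add: carrier_iff)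
  then show ?thesis using norm_bounded order_trans by blast
qed

lemma mult_assoc:
  assumes a: "a \<in> carrier alg" and b: "b \<in> carrier alg" and c: "c \<in> carrier alg"
  shows "(a \<otimes>\<^bsub>alg\<^esub> b) \<otimes>\<^bsub>alg\<^esub> c = a \<otimes>\<^bsub>alg\<^esub> (b \<otimes>\<^bsub>alg\<^esub> c)"
proof (intro ext bcontfun_eqI)
  fix n x
  define g where "g k = apply_bcontfun (c (n - k)) (act (- k) x)" for k
  have "apply_bcontfun (((a \<otimes>\<^bsub>alg\<^esub> b) \<otimes>\<^bsub>alg\<^esub> c) n) x = (\<Sum>\<^sub>\<infinity>k. g k * apply_bcontfun ((a \<otimes>\<^bsub>alg\<^esub> b) k) x)"
    by (simp add: mult_apply mult_closed a b c g_def mult.commute)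
  also have "\<dots> = (\<Sum>\<^sub>\<infinity>k. apply_bcontfun (a k) x * (\<Sum>\<^sub>\<infinity>m. g (k + m) * apply_bcontfun (b m) (act (- k) x)))"
    by (rule weighted_sum_mult[OF a b]) (unfold g_def, rule bounded_coeff[OF c])
  also have "\<dots> = (\<Sum>\<^sub>\<infinity>k. apply_bcontfun (a k) x * apply_bcontfun ((b \<otimes>\<^bsub>alg\<^esub> c) (n - k)) (act (- k) x))"
  proof -
    have "g (k + m) = apply_bcontfun (c (n - k - m)) (act (- m) (act (- k) x))" for k m
      using act_add[of "-m" "-k" x] by (simp add: g_def algebra_simps)
    then show ?thesis by (simp add: mult_apply b c mult.commute)
  qed
  also have "\<dots> = apply_bcontfun ((a \<otimes>\<^bsub>alg\<^esub> (b \<otimes>\<^bsub>alg\<^esub> c)) n) x"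
    by (simp add: mult_apply mult_closed a b c)
  finally show "apply_bcontfun (((a \<otimes>\<^bsub>alg\<^esub> b) \<otimes>\<^bsub>alg\<^esub> c) n) x = apply_bcontfun ((a \<otimes>\<^bsub>alg\<^esub> (b \<otimes>\<^bsub>alg\<^esub> c)) n) x" .
qed

lemma one_apply: "apply_bcontfun (\<one>\<^bsub>alg\<^esub> n) x = (if n = 0 then 1 else 0)"
  by (simp add: ell1_def)

lemma one_closed: "\<one>\<^bsub>alg\<^esub> \<in> carrier alg"
  unfolding carrier_iff by (rule finite_nonzero_values_imp_summable_on) (simp add: ell1_def)

lemma mult_one:
  assumes "a \<in> carrier alg"
  shows "a \<otimes>\<^bsub>alg\<^esub> \<one>\<^bsub>alg\<^esub> = a"
proof (intro ext bcontfun_eqI)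
  fix n x
  show "apply_bcontfun ((a \<otimes>\<^bsub>alg\<^esub> \<one>\<^bsub>alg\<^esub>) n) x = apply_bcontfun (a n) x"
    unfolding mult_apply[OF assms one_closed] one_apply
    by (rule infsumI, rule has_sum_finite_neutralI[of "{n}"]) auto
qed

lemma one_mult:
  assumes "a \<in> carrier alg"
  shows "\<one>\<^bsub>alg\<^esub> \<otimes>\<^bsub>alg\<^esub> a = a"
proof (intro ext bcontfun_eqI)
  fix n x
  show "apply_bcontfun ((\<one>\<^bsub>alg\<^esub> \<otimes>\<^bsub>alg\<^esub> a) n) x = apply_bcontfun (a n) x"
    unfolding mult_apply[OF one_closed assms] one_apply
    by (rule infsumI, rule has_sum_finite_neutralI[of "{0}"]) auto
qed

section \<open>Fourier transform and symbol matrices\<close>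

text \<open>
  The Fourier transform takes the coefficients at a fixed point \<open>x\<close>. It does not respect products;
  the symbol matrix of \<open>b\<close> describes how multiplication by \<open>b\<close> from the left acts on it.
\<close>

definition fourier :: "(int \<Rightarrow> 'x cfun) \<Rightarrow> 'x \<Rightarrow> complex \<Rightarrow> complex" where
  "fourier u x t = (\<Sum>\<^sub>\<infinity>n. apply_bcontfun (u n) x * t powi n)"

definition symbol :: "(int \<Rightarrow> 'x cfun) \<Rightarrow> 'x \<Rightarrow> 'x \<Rightarrow> complex \<Rightarrow> complex" where
  "symbol b x y t = (\<Sum>\<^sub>\<infinity>k. (if act (- k) x = y then apply_bcontfun (b k) x else 0) * t powi k)"

lemma coeff_summable:
  assumes "b \<in> carrier alg"
  shows "(\<lambda>k. norm (apply_bcontfun (b k) x)) summable_on UNIV"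
  using assms norm_summable_iff[of b UNIV] by (auto simp: carrier_iff)

lemma symbol_coeff_summable:
  assumes "b \<in> carrier alg"
  shows "(\<lambda>k. norm (if act (- k) x = y then apply_bcontfun (b k) x else 0)) summable_on UNIV"
  by (rule Infinite_Sum.abs_summable_on_comparison_test'[OF coeff_summable[OF assms, of x]]) simp

lemma wiener_symbol: "b \<in> carrier alg \<Longrightarrow> wiener (symbol b x y)"
  unfolding wiener_def symbol_def[abs_def] by (rule exI, rule wiener_leI[OF symbol_coeff_summable]) auto

lemma fourier_inject:
  assumes u: "u \<in> carrier alg" and v: "v \<in> carrier alg"
    and eq: "\<And>x t. norm t = 1 \<Longrightarrow> fourier u x t = fourier v x t"
  shows "u = v"
proof (intro ext bcontfun_eqI)
  fix n x
  define c where "c k = apply_bcontfun (u k) x - apply_bcontfun (v k) x" for k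
  have "c n = 0"
  proof (rule laurent_coeff_zero)
    show "(\<lambda>k. norm (c k)) summable_on UNIV"
      unfolding c_def
      by (rule Infinite_Sum.abs_summable_on_comparison_test'[OF
            summable_on_add[OF coeff_summable[OF u] coeff_summable[OF v]]]) (rule norm_triangle_ineq4)
    fix t :: complex assume t: "norm t = 1"
    have "((\<lambda>k. apply_bcontfun (u k) x * t powi k + - (apply_bcontfun (v k) x * t powi k))
       has_sum fourier u x t + - fourier v x t) UNIV"
      unfolding fourier_def
      by (rule has_sum_add[OF has_sum_infsum[OF circle_series_summable[OF coeff_summable[OF u] t]]
            has_sum_uminusI[OF has_sum_infsum[OF circle_series_summable[OF coeff_summable[OF v] t]]]])
    then show "((\<lambda>k. c k * t powi k) has_sum 0) UNIV"
      by (simp add: c_def eq[OF t] algebra_simps)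
  qed
  then show "apply_bcontfun (u n) x = apply_bcontfun (v n) x" by (simp add: c_def)
qed

text \<open>
  In \<open>(b u) n x\<close> the \<open>k\<close>-th coefficient of \<open>b\<close> meets \<open>u\<close> at the point \<open>act (- k) x\<close>. Sorting the
  indices \<open>k\<close> by this point turns the series into a finite matrix product.
\<close>

lemma fourier_mult:
  assumes b: "b \<in> carrier alg" and u: "u \<in> carrier alg" and t: "norm t = 1"
  shows "fourier (b \<otimes>\<^bsub>alg\<^esub> u) x t = (\<Sum>y\<in>UNIV. symbol b x y t * fourier u y t)"
proof -
  have t0: "t \<noteq> 0" using t by (rule circle_nonzero)
  have "fourier (b \<otimes>\<^bsub>alg\<^esub> u) x t = (\<Sum>\<^sub>\<infinity>n. t powi n * apply_bcontfun ((b \<otimes>\<^bsub>alg\<^esub> u) n) x)"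
    by (simp add: fourier_def mult.commute)
  also have "\<dots> = (\<Sum>\<^sub>\<infinity>k. apply_bcontfun (b k) x * (\<Sum>\<^sub>\<infinity>m. t powi (k + m) * apply_bcontfun (u m) (act (- k) x)))"
    by (rule weighted_sum_mult[OF b u, of _ 1]) (simp add: norm_circle_powi t)
  also have "\<dots> = (\<Sum>\<^sub>\<infinity>k. apply_bcontfun (b k) x * t powi k * fourier u (act (- k) x) t)"
  proof (rule infsum_cong)
    fix k
    have "(\<Sum>\<^sub>\<infinity>m. t powi (k + m) * apply_bcontfun (u m) (act (- k) x))
        = (\<Sum>\<^sub>\<infinity>m. t powi k * (apply_bcontfun (u m) (act (- k) x) * t powi m))"
      using t0 by (intro infsum_cong) (simp add: power_int_add)
    then show "apply_bcontfun (b k) x * (\<Sum>\<^sub>\<infinity>m. t powi (k + m) * apply_bcontfun (u m) (act (- k) x))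
        = apply_bcontfun (b k) x * t powi k * fourier u (act (- k) x) t"
      by (simp only: infsum_cmult_right' fourier_def mult.assoc)
  qed
  also have "\<dots> = (\<Sum>\<^sub>\<infinity>k. \<Sum>y\<in>UNIV.
      (if act (- k) x = y then apply_bcontfun (b k) x else 0) * t powi k * fourier u y t)"
  proof (rule infsum_cong)
    fix k
    have "(\<Sum>y\<in>UNIV. (if act (- k) x = y then apply_bcontfun (b k) x else 0) * t powi k * fourier u y t)
      = (\<Sum>y\<in>{act (- k) x}. (if act (- k) x = y then apply_bcontfun (b k) x else 0) * t powi k * fourier u y t)"
      by (rule sum.mono_neutral_right[OF fin]) auto
    then show "apply_bcontfun (b k) x * t powi k * fourier u (act (- k) x) t
      = (\<Sum>y\<in>UNIV. (if act (- k) x = y then apply_bcontfun (b k) x else 0) * t powi k * fourier u y t)"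
      by simp
  qed
  also have "\<dots> = (\<Sum>y\<in>UNIV. symbol b x y t * fourier u y t)"
  proof (rule infsumI)
    have summand: "((\<lambda>k. (if act (- k) x = y then apply_bcontfun (b k) x else 0) * t powi k * fourier u y t)
        has_sum symbol b x y t * fourier u y t) UNIV" for y
      unfolding symbol_def
      by (rule has_sum_cmult_left[OF has_sum_infsum[OF circle_series_summable[OF symbol_coeff_summable[OF b] t]]])
    have "finite S \<Longrightarrow> ((\<lambda>k. \<Sum>y\<in>S. (if act (- k) x = y then apply_bcontfun (b k) x else 0) * t powi k * fourier u y t)
        has_sum (\<Sum>y\<in>S. symbol b x y t * fourier u y t)) UNIV" for S
    proof (induction S rule: finite_induct)
      case (insert y S)
      then show ?case using has_sum_add[OF summand[of y] insert.IH] by simp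
    qed simp
    from this[OF fin] show "((\<lambda>k. \<Sum>y\<in>UNIV. (if act (- k) x = y then apply_bcontfun (b k) x else 0) * t powi k * fourier u y t)
        has_sum (\<Sum>y\<in>UNIV. symbol b x y t * fourier u y t)) UNIV" .
  qed
  finally show ?thesis .
qed

lemma fourier_one: "fourier \<one>\<^bsub>alg\<^esub> x t = 1"
  unfolding fourier_def one_apply
  by (rule infsumI, rule has_sum_finite_neutralI[of "{0}"]) auto

text \<open>
  Any functions in the Wiener algebra, one for each point, come from an element of the algebra:
  on a finite Hausdorff space every family of values is continuous.
\<close>

lemma fourier_surj:
  assumes "\<And>x. wiener (f x)"
  obtains u where "u \<in> carrier alg" and "\<And>x t. norm t = 1 \<Longrightarrow> fourier u x t = f x t"
proof -
  have "\<forall>x. \<exists>c :: int \<Rightarrow> complex. (\<lambda>k. norm (c k)) summable_on UNIV \<and>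
     (\<forall>t. norm t = 1 \<longrightarrow> ((\<lambda>k. c k * t powi k) has_sum f x t) UNIV)"
    using assms unfolding wiener_def wiener_le_def by blast
  then obtain c :: "'x \<Rightarrow> int \<Rightarrow> complex" where c: "\<And>x. (\<lambda>k. norm (c x k)) summable_on UNIV"
    "\<And>x t. norm t = 1 \<Longrightarrow> ((\<lambda>k. c x k * t powi k) has_sum f x t) UNIV"
    by metis
  define u where "u n = Bcontfun (\<lambda>x. c x n)" for n
  show ?thesis
  proof
    show "u \<in> carrier alg"
      unfolding carrier_iff norm_summable_iff u_def apply_Bcontfun using c(1) by blast
    show "fourier u x t = f x t" if "norm t = 1" for x t
      unfolding fourier_def u_def apply_Bcontfun by (rule infsumI[OF c(2)[OF that]])
  qed
qed

text \<open>
  The involution sends the index \<open>k\<close> to \<open>- k\<close>, which both reverses the move from \<open>x\<close> to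
  \<open>y = act (- k) x\<close> and matches \<open>cnj (t^k) = t^(- k)\<close> on the circle.
\<close>

lemma symbol_hermitian:
  assumes a: "star alg a = a" and t: "norm t = 1"
  shows "cnj (symbol a x y t) = symbol a y x t"
proof -
  have star: "apply_bcontfun (a n) y = cnj (apply_bcontfun (a (- n)) (act (- n) y))" for n y
  proof -
    have "apply_bcontfun (star alg a n) y = cnj (apply_bcontfun (a (- n)) (act (- n) y))"
      by (simp add: ell1_def apply_cfun_cnj apply_iterate_cfun_auto)
    then show ?thesis by (simp add: a)
  qed
  have orbit: "act (- n) y = x \<longleftrightarrow> act n x = y" for n
    using act_add[of "-n" n x] act_add[of n "-n" y] by auto
  have cnj_t: "cnj t = inverse t"
    using divide_conv_cnj[OF t, of 1] by (simp add: inverse_eq_divide)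
  have "cnj (symbol a x y t) =
      (\<Sum>\<^sub>\<infinity>k. cnj ((if act (- k) x = y then apply_bcontfun (a k) x else 0) * t powi k))"
    unfolding symbol_def by (rule infsum_cnj[symmetric])
  also have "\<dots> = (\<Sum>\<^sub>\<infinity>n. (if act (- n) y = x then apply_bcontfun (a n) y else 0) * t powi n)"
  proof (rule infsum_reindex_bij_witness[of UNIV uminus uminus])
    fix k
    show "(if act (- (- k)) y = x then apply_bcontfun (a (- k)) y else 0) * t powi (- k)
      = cnj ((if act (- k) x = y then apply_bcontfun (a k) x else 0) * t powi k)"
      using orbit[of "- k"] star[of "- k" y]
      by (auto simp: cnj_t power_int_minus power_int_inverse)
  qed auto
  finally show ?thesis by (simp add: symbol_def)
qed

section \<open>Invertibility of the resolvent at non-real points\<close>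

text \<open>
  The additive inverse in the algebra is a definite description over its additive monoid, so it has
  to be identified with the pointwise one.
\<close>

lemma resolvent_eq:
  assumes "a \<in> carrier alg"
  shows "z \<odot>\<^bsub>alg\<^esub> \<one>\<^bsub>alg\<^esub> \<ominus>\<^bsub>alg\<^esub> a = (\<lambda>n. cfun_scale z (\<one>\<^bsub>alg\<^esub> n) - a n)"
proof -
  have "\<ominus>\<^bsub>alg\<^esub> a = (\<lambda>n. - a n)"
    unfolding a_inv_def m_inv_def
  proof (rule the_equality)
    show "(\<lambda>n. - a n) \<in> carrier (add_monoid alg) \<and>
      a \<otimes>\<^bsub>add_monoid alg\<^esub> (\<lambda>n. - a n) = \<one>\<^bsub>add_monoid alg\<^esub> \<and>
      (\<lambda>n. - a n) \<otimes>\<^bsub>add_monoid alg\<^esub> a = \<one>\<^bsub>add_monoid alg\<^esub>"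
      using assms by (simp add: ell1_def)
    show "b = (\<lambda>n. - a n)"
      if "b \<in> carrier (add_monoid alg) \<and> a \<otimes>\<^bsub>add_monoid alg\<^esub> b = \<one>\<^bsub>add_monoid alg\<^esub> \<and>
        b \<otimes>\<^bsub>add_monoid alg\<^esub> a = \<one>\<^bsub>add_monoid alg\<^esub>" for b
    proof
      fix n
      have "b n + a n = 0" using that by (simp add: ell1_def fun_eq_iff)
      then show "b n = - a n" by (simp add: eq_neg_iff_add_eq_0)
    qed
  qed
  then show ?thesis by (simp add: a_minus_def) (simp add: ell1_def)
qed

lemma resolvent_closed:
  assumes "a \<in> carrier alg"
  shows "(\<lambda>n. cfun_scale z (\<one>\<^bsub>alg\<^esub> n) - a n) \<in> carrier alg"
  unfolding carrier_iff norm_summable_iff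
proof
  fix x
  have "(\<lambda>n. norm z * norm (apply_bcontfun (\<one>\<^bsub>alg\<^esub> n) x) + norm (apply_bcontfun (a n) x)) summable_on UNIV"
    by (intro summable_on_add summable_on_cmult_right coeff_summable one_closed assms)
  then show "(\<lambda>n. norm (apply_bcontfun (cfun_scale z (\<one>\<^bsub>alg\<^esub> n) - a n) x)) summable_on UNIV"
    by (rule Infinite_Sum.abs_summable_on_comparison_test')
      (simp add: apply_cfun_scale flip: norm_mult, rule norm_triangle_ineq4)
qed

lemma symbol_resolvent:
  assumes a: "a \<in> carrier alg" and t: "norm t = 1"
  shows "symbol (\<lambda>n. cfun_scale z (\<one>\<^bsub>alg\<^esub> n) - a n) x y t = (if x = y then z else 0) - symbol a x y t"
proof -
  have "((\<lambda>k. (if k = 0 then if x = y then z else 0 else 0) + 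
      - ((if act (- k) x = y then apply_bcontfun (a k) x else 0) * t powi k))
      has_sum (if x = y then z else 0) + - symbol a x y t) UNIV"
    unfolding symbol_def
    by (rule has_sum_add[OF has_sum_finite_neutralI[of "{0}"]
          has_sum_uminusI[OF has_sum_infsum[OF circle_series_summable[OF symbol_coeff_summable[OF a] t]]]]) auto
  moreover have "(if k = 0 then if x = y then z else 0 else 0) + 
      - ((if act (- k) x = y then apply_bcontfun (a k) x else 0) * t powi k)
    = (if act (- k) x = y then apply_bcontfun (cfun_scale z (\<one>\<^bsub>alg\<^esub> k) - a k) x else 0) * t powi k" for k
    by (auto simp: apply_cfun_scale one_apply algebra_simps)
  ultimately have "((\<lambda>k. (if act (- k) x = y then apply_bcontfun (cfun_scale z (\<one>\<^bsub>alg\<^esub> k) - a k) x else 0) * t powi k)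
     has_sum (if x = y then z else 0) - symbol a x y t) UNIV" by simp
  then show ?thesis unfolding symbol_def[of "\<lambda>n. cfun_scale z (\<one>\<^bsub>alg\<^esub> n) - a n"] by (rule infsumI)
qed

text \<open>
  The form of \<open>z - H\<close> at \<open>\<xi>\<close> is \<open>z * \<parallel>\<xi>\<parallel>\<^sup>2\<close> minus the real number \<open>\<langle>\<xi>, H \<xi>\<rangle>\<close>. If it vanishes for
  a non-real \<open>z\<close>, then \<open>\<parallel>\<xi>\<parallel> = 0\<close>.
\<close>

lemma sesq_resolvent_nondegenerate:
  assumes a: "a \<in> carrier alg" "star alg a = a" and z: "z \<notin> \<real>" and t: "norm t = 1"
    and 0: "sesq_form UNIV (\<lambda>x y. symbol (\<lambda>n. cfun_scale z (\<one>\<^bsub>alg\<^esub> n) - a n) x y t) \<xi> = 0"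
  shows "\<xi> x = 0"
proof -
  define q where "q = (\<Sum>x\<in>UNIV. (norm (\<xi> x))\<^sup>2)"
  have "(\<Sum>y\<in>UNIV. (if x = y then z else 0) * \<xi> y) = z * \<xi> x" for x
  proof -
    have "(\<Sum>y\<in>UNIV. (if x = y then z else 0) * \<xi> y) = (\<Sum>y\<in>{x}. (if x = y then z else 0) * \<xi> y)"
      by (rule sum.mono_neutral_right[OF fin]) auto
    then show ?thesis by simp
  qed
  then have "sesq_form UNIV (\<lambda>x y. symbol (\<lambda>n. cfun_scale z (\<one>\<^bsub>alg\<^esub> n) - a n) x y t) \<xi>
    = (\<Sum>x\<in>UNIV. cnj (\<xi> x) * (z * \<xi> x)) - sesq_form UNIV (\<lambda>x y. symbol a x y t) \<xi>"
    unfolding sesq_form_def symbol_resolvent[OF a(1) t] by (simp add: left_diff_distrib right_diff_distrib sum_subtractf)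
  also have "(\<Sum>x\<in>UNIV. cnj (\<xi> x) * (z * \<xi> x)) = z * of_real q"
    unfolding q_def of_real_sum sum_distrib_left complex_norm_square by (simp add: mult_ac)
  finally have "z * of_real q \<in> \<real>"
    using 0 sesq_hermitian_real[of "\<lambda>x y. symbol a x y t" UNIV \<xi>] symbol_hermitian[OF a(2) t] by simp
  then have "q = 0"
    using z by (auto simp: complex_is_Real_iff)
  then have "(norm (\<xi> x))\<^sup>2 = 0"
    unfolding q_def using fin by (subst (asm) sum_nonneg_eq_0_iff) auto
  then show ?thesis by simp
qed

text \<open>
  Solving the linear system with right-hand side \<open>1\<close> gives a right inverse \<open>u\<close>. It is also a left
  inverse because \<open>b (u b) = b\<close> and the symbol matrices of \<open>b\<close> are injective.
\<close>

lemma resolvent_unit: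
  assumes a: "a \<in> carrier alg" "star alg a = a" and z: "z \<notin> \<real>"
  shows "z \<odot>\<^bsub>alg\<^esub> \<one>\<^bsub>alg\<^esub> \<ominus>\<^bsub>alg\<^esub> a \<in> Units alg"
proof -
  define b where "b = (\<lambda>n. cfun_scale z (\<one>\<^bsub>alg\<^esub> n) - a n)"
  have b: "b \<in> carrier alg" unfolding b_def by (rule resolvent_closed[OF a(1)])
  note nondeg = sesq_resolvent_nondegenerate[OF a z, folded b_def]
  obtain f where f: "\<And>x. wiener (f x)"
    "\<And>x t. norm t = 1 \<Longrightarrow> (\<Sum>y\<in>UNIV. symbol b x y t * f y t) = 1"
    using wiener_solve[OF fin, of "symbol b" "\<lambda>_ _. 1"] wiener_symbol[OF b] wiener_const nondeg by fastforce
  obtain u where u: "u \<in> carrier alg" "\<And>x t. norm t = 1 \<Longrightarrow> fourier u x t = f x t"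
    using fourier_surj[of f, OF f(1)] by blast
  have right: "b \<otimes>\<^bsub>alg\<^esub> u = \<one>\<^bsub>alg\<^esub>"
    by (rule fourier_inject[OF mult_closed[OF b u(1)] one_closed])
      (simp add: fourier_mult[OF b u(1)] u(2) f(2) fourier_one)
  define v where "v = u \<otimes>\<^bsub>alg\<^esub> b"
  have v: "v \<in> carrier alg" unfolding v_def by (rule mult_closed[OF u(1) b])
  have bv: "b \<otimes>\<^bsub>alg\<^esub> v = b \<otimes>\<^bsub>alg\<^esub> \<one>\<^bsub>alg\<^esub>"
    unfolding v_def mult_assoc[OF b u(1) b, symmetric] right one_mult[OF b] mult_one[OF b] ..
  have left: "v = \<one>\<^bsub>alg\<^esub>"
  proof (rule fourier_inject[OF v one_closed])
    fix x t assume t: "norm (t :: complex) = 1"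
    have "sesq_form UNIV (\<lambda>x y. symbol b x y t) (\<lambda>y. fourier v y t - fourier \<one>\<^bsub>alg\<^esub> y t) = 0"
      unfolding sesq_form_def
      by (simp only: right_diff_distrib sum_subtractf fourier_mult[OF b _ t, symmetric] v one_closed bv)
        simp
    from nondeg[OF t this] show "fourier v x t = fourier \<one>\<^bsub>alg\<^esub> x t" by simp
  qed
  show ?thesis
    unfolding resolvent_eq[OF a(1), of z, folded b_def] Units_def
    using b u(1) right left[unfolded v_def] by auto
qed

end

theorem theorem4p6:
  fixes \<sigma> :: "'x::t2_space \<Rightarrow> 'x"
  assumes "compact (UNIV :: 'x set)"
    and "\<exists>\<tau>. homeomorphism UNIV UNIV \<sigma> \<tau>"
    and "finite (UNIV :: 'x set)"
  shows "hermitian (ell1 \<sigma>)"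
proof -
  obtain \<tau> where "homeomorphism UNIV UNIV \<sigma> \<tau>" using assms(2) by blast
  then interpret finite_system \<sigma> \<tau> using assms(3) by unfold_locales
  show ?thesis
    unfolding hermitian_def spectrum_def using resolvent_unit by blast
qed

end
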